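(* Let $(c_1,c_2):[0,T]\times\mathbb{R}^n\rightarrow\mathbb{R}^2$ be a continuous function satisfying the following four conditions: (F1) $c_i(T,x)=\sigma_i(x)$ for all $x\in\mathbb{R}^n$, $i=1,2$; (F2) for every $(t_*,x_* )\in[0,T]\times\mathbb{R}^n$ and $u\in P$ there exists a motion $y^2(\cdot)\in \mathrm{Sol}^2(t_*,x_*;u)$ such that $c_1(t,y^2(t))\leq c_1(t_*,x_* )$ for all $t\in[t_*,T]$; (F3) for every $(t_*,x_* )\in[0,T]\times\mathbb{R}^n$ and $v\in Q$ there exists a motion $y^1(\cdot)\in \mathrm{Sol}^1(t_*,x_*;v)$ such that $c_2(t,y^1(t))\leq c_2(t_*,x_* )$ for all $t\in[t_*,T]$; (F4) for every $(t_*,x_* )\in[0,T]\times\mathbb{R}^n$ there exists a motion $y^{(c)}(\cdot)\in \mathrm{Sol}(t_*,x_* )$ such that $c_i(t,y^{(c)}(t))=c_i(t_*,x_* )$ for all $t\in[t_*,T]$, $i=1,2$. Then for each compact $G\subset[0,T]\times\mathbb{R}^n$ there exists a Control with Guide Nash equilibrium on $G$ such that, for every $(t_0,x_0)\in G$, the corresponding payoff of player $i$ at $(t_0,x_0)$ is $c_i(t_0,x_0)$, $i=1,2$.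
   Context: Game. Consider the two-player differential game $\dot x=f(t,x,u)+g(t,x,v)$, $t\in[0,T]$, $x\in\mathbb{R}^n$, $u\in P$ (control of player I), $v\in Q$ (control of player II). Player $i$ wants to maximize $\sigma_i(x(T))$, $i=1,2$. The sets $P$ and $Q$ are (nonempty) compact; $f,g,\sigma_1,\sigma_2$ are continuous; $f$ and $g$ are Lipschitz continuous with respect to $x$ and satisfy the sublinear growth condition with respect to $x$. Let $\mathcal{U}$ (resp. $\mathcal{V}$) be the set of measurable functions $[0,T]\to P$ (resp. $[0,T]\to Q$). For $u\in\mathcal{U}$, $v\in\mathcal{V}$, $x(\cdot,t_0,x_0,u,v)$ is the solution of $\dot x(t)=f(t,x(t),u(t))+g(t,x(t),v(t))$, $x(t_0)=x_0$; an element of $P$ or $Q$ in place of $u$ or $v$ means the constant control. Sets of motions. With closures taken in the space of continuous vector functions on $[0,T]$: $\mathrm{Sol}^1(t_*,x_*;v_* ):=\mathrm{cl}\{x(\cdot,t_*,x_*,u,v_* ):u\in\mathcal{U}\}$ for $v_*\in Q$; $\mathrm{Sol}^2(t_*,x_*;u_* ):=\mathrm{cl}\{x(\cdot,t_*,x_*,u_*,v):v\in\mathcal{V}\}$ for $u_*\in P$; $\mathrm{Sol}(t_*,x_* ):=\mathrm{cl}\{x(\cdot,t_*,x_*,u,v):u\in\mathcal{U},v\in\mathcal{V}\}$. Control with guide strategies. A control with guide strategy of player I is a triple of functions $U=(u,\psi^1,\chi^1)$ such that for some natural $m$: $u:[0,T]\times\mathbb{R}^n\times\mathbb{R}^m\to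 P$, $\psi^1:[0,T]\times[0,T]\times\mathbb{R}^n\times\mathbb{R}^m\to\mathbb{R}^m$, $\chi^1:[0,T]\times\mathbb{R}^n\to\mathbb{R}^m$. A control with guide strategy of player II is a triple $V=(v,\psi^2,\chi^2)$ defined analogously, with $v$ taking values in $Q$ (the guide dimension may be different). For a partition $\Delta=\{t_k\}_{k=0}^r$ of $[t_0,T]$, $d(\Delta)$ is its mesh (largest step). Motions. (a) For $v[\cdot]\in\mathcal{V}$, $x^1[\cdot,t_0,x_0,U,\Delta,v[\cdot]]$ is the solution of the dynamics on $[t_0,T]$ with $x[t_0]=x_0$, where player II uses $v[\cdot]$ and player I uses the constant control $u(t_k,x_k,w^1_k)$ on $[t_k,t_{k+1})$, with $x_k=x[t_k]$, $w^1_0=\chi^1(t_0,x_0)$, $w^1_k=\psi^1(t_k,t_{k-1},x_{k-1},w^1_{k-1})$ for $k\ge1$. (b) For $u[\cdot]\in\mathcal{U}$, $x^2[\cdot,t_0,x_0,V,\Delta,u[\cdot]]$ is defined symmetrically: player I uses $u[\cdot]$ and player II uses $v(t_k,x_k,w^2_k)$ on $[t_k,t_{k+1})$, with $w^2_0=\chi^2(t_0,x_0)$, $w^2_k=\psi^2(t_k,t_{k-1},x_{k-1},w^2_{k-1})$. (c) $x^{(c)}[\cdot,t_0,x_0,U,V,\Delta]$ is the solution with $x[t_0]=x_0$ where on $[t_k,t_{k+1})$ player I uses $u(t_k,x_k,w^1_k)$ and player II uses $v(t_k,x_k,w^2_k)$, with $w^i_0=\chi^i(t_0,x_0)$, $w^i_{k+1}=\psi^i(t_{k+1},t_k,x_k,w^i_k)$,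 $i=1,2$. Equilibrium. For $G\subset[0,T]\times\mathbb{R}^n$, a pair $(U^*,V^* )$ of control with guide strategies is a Control with Guide Nash equilibrium on $G$ if for all $(t_0,x_0)\in G$: $$\lim_{\delta\downarrow0}\sup\{\sigma_1(x^2[T,t_0,x_0,V^*,\Delta,u[\cdot]]):d(\Delta)\le\delta,\ u[\cdot]\in\mathcal{U}\}\le\lim_{\delta\downarrow0}\inf\{\sigma_1(x^{(c)}[T,t_0,x_0,U^*,V^*,\Delta]):d(\Delta)\le\delta\},$$ $$\lim_{\delta\downarrow0}\sup\{\sigma_2(x^1[T,t_0,x_0,U^*,\Delta,v[\cdot]]):d(\Delta)\le\delta,\ v[\cdot]\in\mathcal{V}\}\le\lim_{\delta\downarrow0}\inf\{\sigma_2(x^{(c)}[T,t_0,x_0,U^*,V^*,\Delta]):d(\Delta)\le\delta\},$$ where $\Delta$ ranges over partitions of $[t_0,T]$. The corresponding payoff of player $i$ at $(t_0,x_0)$ is $\lim_{\delta\downarrow0}\inf\{\sigma_i(x^{(c)}[T,t_0,x_0,U^*,V^*,\Delta]):d(\Delta)\le\delta\}$. *)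

theory Defs
  imports "HOL-Analysis.Analysis"
begin

definition lipschitz_in_state ::
  "real \<Rightarrow> 'p set \<Rightarrow> (real \<Rightarrow> 'x::metric_space \<Rightarrow> 'p \<Rightarrow> 'x) \<Rightarrow> bool" where
  "lipschitz_in_state T P f \<longleftrightarrow>
     (\<exists>L. \<forall>t\<in>{0..T}. \<forall>u\<in>P. L-lipschitz_on UNIV (\<lambda>x. f t x u))"

definition sublinear_growth ::
  "real \<Rightarrow> 'p set \<Rightarrow> (real \<Rightarrow> 'x::real_normed_vector \<Rightarrow> 'p \<Rightarrow> 'x) \<Rightarrow> bool" where
  "sublinear_growth T P f \<longleftrightarrow>
     (\<exists>C. \<forall>t\<in>{0..T}. \<forall>x. \<forall>u\<in>P. norm (f t x u) \<le> C * (1 + norm x))"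

definition open_loop_controls :: "real \<Rightarrow> 'p::metric_space set \<Rightarrow> (real \<Rightarrow> 'p) set" where
  "open_loop_controls T P =
     {u. u \<in> borel_measurable (lebesgue_on {0..T}) \<and> (\<forall>t\<in>{0..T}. u t \<in> P)}"

text \<open>Caratheodory solution on \<open>{a..b}\<close>, in integral form. No initial condition is included, so
  that it may be imposed at any point of the interval.\<close>

definition solution_on ::
  "(real \<Rightarrow> 'x::euclidean_space \<Rightarrow> 'p \<Rightarrow> 'x) \<Rightarrow> (real \<Rightarrow> 'x \<Rightarrow> 'q \<Rightarrow> 'x) \<Rightarrow>
   real \<Rightarrow> real \<Rightarrow> (real \<Rightarrow> 'p) \<Rightarrow> (real \<Rightarrow> 'q) \<Rightarrow> (real \<Rightarrow> 'x) \<Rightarrow> bool" where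
  "solution_on f g a b u v x \<longleftrightarrow>
     (\<lambda>s. f s (x s) (u s) + g s (x s) (v s)) absolutely_integrable_on {a..b} \<and>
     (\<forall>t\<in>{a..b}. ((\<lambda>s. f s (x s) (u s) + g s (x s) (v s)) has_integral (x t - x a)) {a..t})"

text \<open>Motions from \<open>(t\<^sub>0, x\<^sub>0)\<close> are defined on all of \<open>{0..T}\<close>, hence also backward in time from
  \<open>t\<^sub>0\<close>, and are viewed as points of the library space \<^const>\<open>cfunspace\<close> of continuous functions on
  \<open>{0..T}\<close> with the uniform metric, whose elements are \<^const>\<open>extensional\<close>.\<close>

definition motions ::
  "real \<Rightarrow> (real \<Rightarrow> 'x::euclidean_space \<Rightarrow> 'p \<Rightarrow> 'x) \<Rightarrow> (real \<Rightarrow> 'x \<Rightarrow> 'q \<Rightarrow> 'x) \<Rightarrow>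
   (real \<Rightarrow> 'p) set \<Rightarrow> (real \<Rightarrow> 'q) set \<Rightarrow> real \<Rightarrow> 'x \<Rightarrow> (real \<Rightarrow> 'x) set" where
  "motions T f g \<U> \<V> t\<^sub>0 x\<^sub>0 =
     {x \<in> extensional {0..T}. x t\<^sub>0 = x\<^sub>0 \<and> (\<exists>u\<in>\<U>. \<exists>v\<in>\<V>. solution_on f g 0 T u v x)}"

definition motion_closure :: "real \<Rightarrow> (real \<Rightarrow> 'x::euclidean_space) set \<Rightarrow> (real \<Rightarrow> 'x) set" where
  "motion_closure T X =
     mtopology_of (cfunspace (top_of_set {0..T}) euclidean_metric) closure_of X"

definition Sol1 ::
  "real \<Rightarrow> (real \<Rightarrow> 'x::euclidean_space \<Rightarrow> 'p::metric_space \<Rightarrow> 'x) \<Rightarrow> (real \<Rightarrow> 'x \<Rightarrow> 'q \<Rightarrow> 'x) \<Rightarrow>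
   'p set \<Rightarrow> real \<Rightarrow> 'x \<Rightarrow> 'q \<Rightarrow> (real \<Rightarrow> 'x) set" where
  "Sol1 T f g P t\<^sub>0 x\<^sub>0 v\<^sub>0 =
     motion_closure T (motions T f g (open_loop_controls T P) {\<lambda>_. v\<^sub>0} t\<^sub>0 x\<^sub>0)"

definition Sol2 ::
  "real \<Rightarrow> (real \<Rightarrow> 'x::euclidean_space \<Rightarrow> 'p \<Rightarrow> 'x) \<Rightarrow> (real \<Rightarrow> 'x \<Rightarrow> 'q::metric_space \<Rightarrow> 'x) \<Rightarrow>
   'q set \<Rightarrow> real \<Rightarrow> 'x \<Rightarrow> 'p \<Rightarrow> (real \<Rightarrow> 'x) set" where
  "Sol2 T f g Q t\<^sub>0 x\<^sub>0 u\<^sub>0 =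
     motion_closure T (motions T f g {\<lambda>_. u\<^sub>0} (open_loop_controls T Q) t\<^sub>0 x\<^sub>0)"

definition Sol ::
  "real \<Rightarrow> (real \<Rightarrow> 'x::euclidean_space \<Rightarrow> 'p::metric_space \<Rightarrow> 'x) \<Rightarrow>
   (real \<Rightarrow> 'x \<Rightarrow> 'q::metric_space \<Rightarrow> 'x) \<Rightarrow> 'p set \<Rightarrow> 'q set \<Rightarrow> real \<Rightarrow> 'x \<Rightarrow> (real \<Rightarrow> 'x) set" where
  "Sol T f g P Q t\<^sub>0 x\<^sub>0 =
     motion_closure T (motions T f g (open_loop_controls T P) (open_loop_controls T Q) t\<^sub>0 x\<^sub>0)"

text \<open>A guide variable ranges over \<open>\<real>\<^sup>m\<close>, where \<open>m\<close> is part of the strategy and therefore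
  existentially quantified. It is rendered as the set \<open>topspace (Euclidean_space m)\<close> of sequences
  vanishing from index \<open>m\<close> on. The fields are the triple \<open>(u, \<psi>, \<chi>)\<close>.\<close>

record ('x, 'p) guide_strategy =
  control :: "real \<Rightarrow> 'x \<Rightarrow> (nat \<Rightarrow> real) \<Rightarrow> 'p"
  guide_step :: "real \<Rightarrow> real \<Rightarrow> 'x \<Rightarrow> (nat \<Rightarrow> real) \<Rightarrow> nat \<Rightarrow> real"
  guide_init :: "real \<Rightarrow> 'x \<Rightarrow> nat \<Rightarrow> real"

definition is_guide_strategy :: "real \<Rightarrow> 'p set \<Rightarrow> ('x, 'p) guide_strategy \<Rightarrow> bool" where
  "is_guide_strategy T P U \<longleftrightarrow>
     (\<exists>m>0. (\<forall>t\<in>{0..T}. \<forall>x. \<forall>w\<in>topspace (Euclidean_space m). control U t x w \<in> P) \<and>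
            (\<forall>t\<in>{0..T}. \<forall>s\<in>{0..T}. \<forall>x. \<forall>w\<in>topspace (Euclidean_space m).
               guide_step U t s x w \<in> topspace (Euclidean_space m)) \<and>
            (\<forall>t\<in>{0..T}. \<forall>x. guide_init U t x \<in> topspace (Euclidean_space m)))"

text \<open>The partition \<open>\<tau> 0 < \<dots> < \<tau> r\<close>; necessarily \<open>r = 0\<close> if \<open>a = b\<close>.\<close>

definition partition_of :: "real \<Rightarrow> real \<Rightarrow> nat \<Rightarrow> (nat \<Rightarrow> real) \<Rightarrow> bool" where
  "partition_of a b r \<tau> \<longleftrightarrow> \<tau> 0 = a \<and> \<tau> r = b \<and> (\<forall>k<r. \<tau> k < \<tau> (Suc k))"

definition mesh :: "nat \<Rightarrow> (nat \<Rightarrow> real) \<Rightarrow> real" where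
  "mesh r \<tau> = Max (insert 0 ((\<lambda>k. \<tau> (Suc k) - \<tau> k) ` {..<r}))"

primrec guide :: "('x, 'p) guide_strategy \<Rightarrow> (nat \<Rightarrow> real) \<Rightarrow> (real \<Rightarrow> 'x) \<Rightarrow> nat \<Rightarrow> nat \<Rightarrow> real" where
  "guide U \<tau> x 0 = guide_init U (\<tau> 0) (x (\<tau> 0))"
| "guide U \<tau> x (Suc k) = guide_step U (\<tau> (Suc k)) (\<tau> k) (x (\<tau> k)) (guide U \<tau> x k)"

definition feedback :: "('x, 'p) guide_strategy \<Rightarrow> (nat \<Rightarrow> real) \<Rightarrow> (real \<Rightarrow> 'x) \<Rightarrow> nat \<Rightarrow> 'p" where
  "feedback U \<tau> x k = control U (\<tau> k) (x (\<tau> k)) (guide U \<tau> x k)"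

text \<open>A motion on \<open>{t\<^sub>0..T}\<close> with \<open>t\<^sub>0 = \<tau> 0\<close> and \<open>T = \<tau> r\<close>, where the controls \<open>u k\<close> and \<open>v k\<close> are
  used between \<open>\<tau> k\<close> and \<open>\<tau> (Suc k)\<close>. Below, these controls depend on the motion itself through
  its values at \<open>\<tau> 0, \<dots>, \<tau> k\<close>.\<close>

definition stepwise_motion ::
  "(real \<Rightarrow> 'x::euclidean_space \<Rightarrow> 'p \<Rightarrow> 'x) \<Rightarrow> (real \<Rightarrow> 'x \<Rightarrow> 'q \<Rightarrow> 'x) \<Rightarrow> 'x \<Rightarrow> nat \<Rightarrow> (nat \<Rightarrow> real) \<Rightarrow>
   (nat \<Rightarrow> real \<Rightarrow> 'p) \<Rightarrow> (nat \<Rightarrow> real \<Rightarrow> 'q) \<Rightarrow> (real \<Rightarrow> 'x) \<Rightarrow> bool" where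
  "stepwise_motion f g x\<^sub>0 r \<tau> u v x \<longleftrightarrow>
     x (\<tau> 0) = x\<^sub>0 \<and> (\<forall>k<r. solution_on f g (\<tau> k) (\<tau> (Suc k)) (u k) (v k) x)"

definition motion1 where
  "motion1 f g x\<^sub>0 U r \<tau> v x \<longleftrightarrow>
     stepwise_motion f g x\<^sub>0 r \<tau> (\<lambda>k _. feedback U \<tau> x k) (\<lambda>_. v) x"

definition motion2 where
  "motion2 f g x\<^sub>0 V r \<tau> u x \<longleftrightarrow>
     stepwise_motion f g x\<^sub>0 r \<tau> (\<lambda>_. u) (\<lambda>k _. feedback V \<tau> x k) x"

definition motion_c where
  "motion_c f g x\<^sub>0 U V r \<tau> x \<longleftrightarrow>
     stepwise_motion f g x\<^sub>0 r \<tau> (\<lambda>k _. feedback U \<tau> x k) (\<lambda>k _. feedback V \<tau> x k) x"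

definition outcomes1 ::
  "real \<Rightarrow> (real \<Rightarrow> 'x::euclidean_space \<Rightarrow> 'p \<Rightarrow> 'x) \<Rightarrow> (real \<Rightarrow> 'x \<Rightarrow> 'q::metric_space \<Rightarrow> 'x) \<Rightarrow>
   'q set \<Rightarrow> ('x, 'p) guide_strategy \<Rightarrow> real \<Rightarrow> 'x \<Rightarrow> real \<Rightarrow> 'x set" where
  "outcomes1 T f g Q U t\<^sub>0 x\<^sub>0 \<delta> =
     {x T | x r \<tau> v. partition_of t\<^sub>0 T r \<tau> \<and> mesh r \<tau> \<le> \<delta> \<and> v \<in> open_loop_controls T Q \<and>
        motion1 f g x\<^sub>0 U r \<tau> v x}"

definition outcomes2 ::
  "real \<Rightarrow> (real \<Rightarrow> 'x::euclidean_space \<Rightarrow> 'p::metric_space \<Rightarrow> 'x) \<Rightarrow> (real \<Rightarrow> 'x \<Rightarrow> 'q \<Rightarrow> 'x) \<Rightarrow>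
   'p set \<Rightarrow> ('x, 'q) guide_strategy \<Rightarrow> real \<Rightarrow> 'x \<Rightarrow> real \<Rightarrow> 'x set" where
  "outcomes2 T f g P V t\<^sub>0 x\<^sub>0 \<delta> =
     {x T | x r \<tau> u. partition_of t\<^sub>0 T r \<tau> \<and> mesh r \<tau> \<le> \<delta> \<and> u \<in> open_loop_controls T P \<and>
        motion2 f g x\<^sub>0 V r \<tau> u x}"

definition outcomes_c ::
  "real \<Rightarrow> (real \<Rightarrow> 'x::euclidean_space \<Rightarrow> 'p \<Rightarrow> 'x) \<Rightarrow> (real \<Rightarrow> 'x \<Rightarrow> 'q \<Rightarrow> 'x) \<Rightarrow>
   ('x, 'p) guide_strategy \<Rightarrow> ('x, 'q) guide_strategy \<Rightarrow> real \<Rightarrow> 'x \<Rightarrow> real \<Rightarrow> 'x set" where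
  "outcomes_c T f g U V t\<^sub>0 x\<^sub>0 \<delta> =
     {x T | x r \<tau>. partition_of t\<^sub>0 T r \<tau> \<and> mesh r \<tau> \<le> \<delta> \<and> motion_c f g x\<^sub>0 U V r \<tau> x}"

text \<open>Suprema and infima are taken in \<^typ>\<open>ereal\<close>, so the limits below, being limits of monotone
  functions of \<open>\<delta>\<close>, always exist and no boundedness is presupposed.\<close>

definition payoff ::
  "real \<Rightarrow> (real \<Rightarrow> 'x::euclidean_space \<Rightarrow> 'p \<Rightarrow> 'x) \<Rightarrow> (real \<Rightarrow> 'x \<Rightarrow> 'q \<Rightarrow> 'x) \<Rightarrow> ('x \<Rightarrow> real) \<Rightarrow>
   ('x, 'p) guide_strategy \<Rightarrow> ('x, 'q) guide_strategy \<Rightarrow> real \<Rightarrow> 'x \<Rightarrow> ereal" where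
  "payoff T f g \<sigma> U V t\<^sub>0 x\<^sub>0 =
     Lim (at_right 0) (\<lambda>\<delta>. INF y\<in>outcomes_c T f g U V t\<^sub>0 x\<^sub>0 \<delta>. ereal (\<sigma> y))"

definition nash_equilibrium_on ::
  "real \<Rightarrow> (real \<Rightarrow> 'x::euclidean_space \<Rightarrow> 'p::metric_space \<Rightarrow> 'x) \<Rightarrow>
   (real \<Rightarrow> 'x \<Rightarrow> 'q::metric_space \<Rightarrow> 'x) \<Rightarrow> 'p set \<Rightarrow> 'q set \<Rightarrow> ('x \<Rightarrow> real) \<Rightarrow> ('x \<Rightarrow> real) \<Rightarrow>
   (real \<times> 'x) set \<Rightarrow> ('x, 'p) guide_strategy \<Rightarrow> ('x, 'q) guide_strategy \<Rightarrow> bool" where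
  "nash_equilibrium_on T f g P Q \<sigma>1 \<sigma>2 G U V \<longleftrightarrow>
     is_guide_strategy T P U \<and> is_guide_strategy T Q V \<and>
     (\<forall>(t\<^sub>0, x\<^sub>0)\<in>G.
        Lim (at_right 0) (\<lambda>\<delta>. SUP y\<in>outcomes2 T f g P V t\<^sub>0 x\<^sub>0 \<delta>. ereal (\<sigma>1 y))
          \<le> payoff T f g \<sigma>1 U V t\<^sub>0 x\<^sub>0 \<and>
        Lim (at_right 0) (\<lambda>\<delta>. SUP y\<in>outcomes1 T f g Q U t\<^sub>0 x\<^sub>0 \<delta>. ereal (\<sigma>2 y))
          \<le> payoff T f g \<sigma>2 U V t\<^sub>0 x\<^sub>0)"

end

theory Submission
  imports Defs
begin

text \<open>
  Each player steers the state towards a \<^emph>\<open>guide\<close>, a fictitious point \<open>w\<close> which starts at \<open>x\<^sub>0\<close> and moves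
  along limits of open-loop motions on which \<open>c1\<close> and \<open>c2\<close> behave well. On each interval of the
  partition the player uses the control that points most strongly in the direction \<open>w - x\<close> from the
  state to the guide (extremal shift). If, in this direction, the controls that move the state are
  at least as good as those that move the guide, then the squared distance \<open>E\<close> obeys
  \<open>E' \<le> (1 + 4 L h) E + h \<kappa>(h)\<close> over a step of length \<open>h\<close>, with \<open>\<kappa>(h) \<rightarrow> 0\<close>
  (\<open>extremal_shift\<close>). Since the dynamics is a sum \<open>f + g\<close>, the two players contribute to the
  comparison independently of each other.

  There are two kinds of guide steps. In a \<^emph>\<open>cooperative\<close> step the guide follows a motion that keeps both
  \<open>c1\<close> and \<open>c2\<close> constant; the comparison holds if both players shift extremally. In a
  \<^emph>\<open>punishing\<close> step of player I the guide follows a motion in which player II is held at the control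
  that is worst for approaching the guide, and along which \<open>c2\<close> does not increase. Then the comparison
  holds whatever player II actually does.

  To decide between the two, the guide also carries a tolerance \<open>\<theta>\<close>, which starts at \<open>0\<close> and grows by
  the recursion that bounds \<open>E\<close>; this needs no advance knowledge of the mesh. The step is
  cooperative if \<open>E \<le> \<theta>\<close> and punishing otherwise. If both players use their strategies,
  then \<open>E \<le> \<theta>\<close> forever, the two guides coincide, and the final state is close to a point \<open>w\<close> with
  \<open>c1 T w = c1 t\<^sub>0 x\<^sub>0\<close> and \<open>c2 T w = c2 t\<^sub>0 x\<^sub>0\<close> (\<open>cooperation_outcome\<close>). If player II plays arbitrarily, a
  cooperative step may let \<open>E\<close> exceed \<open>\<theta>\<close>, but only by a multiple of the mesh, and the following
  punishing steps preserve this bound up to the same recursion, while \<open>c2\<close> never increases along the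
  guide. So the final state is close to a point \<open>w\<close> with \<open>c2 T w \<le> c2 t\<^sub>0 x\<^sub>0\<close> (\<open>deviation_outcome\<close>).
  As \<open>c1 T\<close> and \<open>c2 T\<close> are the payoff functions, both statements pass to the limit of small
  meshes. Player II is treated by exchanging \<open>f\<close> and \<open>g\<close>.

  An infimum over no outcomes would be \<open>\<infinity>\<close>, so the payoffs also require motions to exist for
  arbitrarily fine partitions (\<open>outcomes_c_nonempty\<close>).
\<close>

section \<open>Moduli of continuity and a Gronwall inequality\<close>

lemma modulus_of_continuity:
  fixes F :: "'a::metric_space \<Rightarrow> 'b::metric_space"
  assumes "compact S" "continuous_on S F"
  obtains \<omega> :: "real \<Rightarrow> real"
  where "\<And>h h'. 0 \<le> h \<Longrightarrow> h \<le> h' \<Longrightarrow> \<omega> h \<le> \<omega> h'" "\<And>h. 0 \<le> h \<Longrightarrow> 0 \<le> \<omega> h"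
    "(\<omega> \<longlongrightarrow> 0) (at_right 0)"
    "\<And>h p q. p \<in> S \<Longrightarrow> q \<in> S \<Longrightarrow> dist p q \<le> h \<Longrightarrow> dist (F p) (F q) \<le> \<omega> h"
proof -
  define D where "D h = insert 0 {dist (F p) (F q) |p q. p \<in> S \<and> q \<in> S \<and> dist p q \<le> h}" for h
  have "bounded (F ` S)"
    by (intro compact_imp_bounded compact_continuous_image assms)
  then obtain B where B: "\<And>p q. p \<in> S \<Longrightarrow> q \<in> S \<Longrightarrow> dist (F p) (F q) \<le> B"
    by (auto simp: bounded_two_points)
  have bdd: "bdd_above (D h)" for h
    by (rule bdd_aboveI[of _ "max 0 B"]) (auto simp: D_def dest: B)
  have nonneg: "0 \<le> Sup (D h)" for h
    using bdd by (intro cSup_upper) (auto simp: D_def)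
  show thesis
  proof (rule that[of "\<lambda>h. Sup (D h)"])
    show "Sup (D h) \<le> Sup (D h')" if "0 \<le> h" "h \<le> h'" for h h'
      using that by (intro cSup_subset_mono bdd) (force simp: D_def)+
    show "dist (F p) (F q) \<le> Sup (D h)" if "p \<in> S" "q \<in> S" "dist p q \<le> h" for p q h
      using bdd that by (intro cSup_upper) (auto simp: D_def)
    show "((\<lambda>h. Sup (D h)) \<longlongrightarrow> 0) (at_right 0)"
    proof (rule tendstoI)
      fix e :: real assume "0 < e"
      obtain d where d: "0 < d" "\<And>p q. p \<in> S \<Longrightarrow> q \<in> S \<Longrightarrow> dist p q < d \<Longrightarrow> dist (F p) (F q) < e/2"
        using compact_uniformly_continuous[OF assms(2,1)] \<open>0 < e\<close>
        unfolding uniformly_continuous_on_def by (metis dist_commute half_gt_zero)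
      have "r \<le> e/2" if "h < d" "r \<in> D h" for h r
        using that \<open>0 < e\<close> d(2) by (fastforce simp: D_def intro: less_imp_le)
      then have "Sup (D h) \<le> e/2" if "h < d" for h
        using that by (intro cSup_least) (auto simp: D_def)
      then show "\<forall>\<^sub>F h in at_right 0. dist (Sup (D h)) 0 < e"
        unfolding eventually_at_right_field using nonneg \<open>0 < d\<close> \<open>0 < e\<close>
        by (intro exI[of _ d]) (auto simp: dist_real_def intro: le_less_trans[of _ "e/2"])
    qed
  qed (use nonneg in auto)
qed

text \<open>The function \<open>exp (- K (t - a)) (A + K \<integral> \<phi>)\<close> is nonincreasing, because the hypothesis says that its
  derivative is nonpositive.\<close>

lemma gronwall:
  fixes \<phi> :: "real \<Rightarrow> real"
  assumes "a \<le> b" "0 \<le> K" and cont: "continuous_on {a..b} \<phi>"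
    and le: "\<And>t. t \<in> {a..b} \<Longrightarrow> \<phi> t \<le> A + K * integral {a..t} \<phi>"
  shows "\<phi> b \<le> A * exp (K * (b - a))"
proof -
  define \<psi> where "\<psi> t = exp (- (K * (t - a))) * (A + K * integral {a..t} \<phi>)" for t
  have "\<psi> b \<le> \<psi> a"
  proof (rule DERIV_nonpos_imp_decreasing_open[where f = \<psi>])
    show "continuous_on {a..b} \<psi>" unfolding \<psi>_def
      by (intro continuous_intros indefinite_integral_continuous_1 integrable_continuous_real cont)
    fix t assume t: "a < t" "t < b"
    have "((\<lambda>t. integral {a..t} \<phi>) has_real_derivative \<phi> t) (at t within {a..b})"
      using t by (intro integral_has_real_derivative cont) auto
    then have *: "((\<lambda>t. integral {a..t} \<phi>) has_real_derivative \<phi> t) (at t)"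
      using t by (simp add: at_within_Icc_at)
    have "(\<psi> has_real_derivative
        exp (- (K * (t - a))) * K * (\<phi> t - (A + K * integral {a..t} \<phi>))) (at t)"
      unfolding \<psi>_def
      by (rule DERIV_cong[OF DERIV_mult[OF DERIV_fun_exp[OF DERIV_minus[OF DERIV_cmult[OF
            DERIV_diff[OF DERIV_ident DERIV_const]]]] DERIV_add[OF DERIV_const DERIV_cmult[OF *]]]])
         (simp add: algebra_simps)
    moreover have "exp (- (K * (t - a))) * K * (\<phi> t - (A + K * integral {a..t} \<phi>)) \<le> 0"
      using le[of t] t \<open>0 \<le> K\<close> by (intro mult_nonneg_nonpos) auto
    ultimately show "\<exists>y. (\<psi> has_real_derivative y) (at t) \<and> y \<le> 0" by blast
  qed (use \<open>a \<le> b\<close> in auto)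
  then have "A + K * integral {a..b} \<phi> \<le> A * exp (K * (b - a))"
    by (simp add: \<psi>_def exp_minus divide_inverse[symmetric] mult.commute[of "inverse _"] pos_divide_le_eq)
  then show ?thesis using le[of b] \<open>a \<le> b\<close> by auto
qed

section \<open>Solutions of the control system\<close>

lemma solution_on_swap: "solution_on g f a b v u x \<longleftrightarrow> solution_on f g a b u v x"
  by (simp add: solution_on_def add.commute)

lemma solution_on_subinterval:
  assumes sol: "solution_on f g a b u v x" and "a \<le> s" "s \<le> t" "t \<le> b"
  shows "solution_on f g s t u v x"
proof -
  let ?F = "\<lambda>s. f s (x s) (u s) + g s (x s) (v s)"
  have abs: "?F absolutely_integrable_on {a..b}"
    and int: "\<And>r. r \<in> {a..b} \<Longrightarrow> (?F has_integral (x r - x a)) {a..r}"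
    using sol by (auto simp: solution_on_def)
  have "?F absolutely_integrable_on {s..t}"
    using assms by (intro absolutely_integrable_on_subinterval[OF abs]) auto
  moreover have "(?F has_integral (x r - x s)) {s..r}" if r: "r \<in> {s..t}" for r
  proof -
    have "?F integrable_on {a..r}" using int[of r] r assms by (auto simp: has_integral_integrable)
    moreover from this have "?F integrable_on {s..r}"
      using r assms by (auto intro: integrable_on_subinterval)
    moreover have "integral {a..s} ?F + integral {s..r} ?F = integral {a..r} ?F"
      using calculation r assms by (intro Henstock_Kurzweil_Integration.integral_combine) auto
    moreover have "integral {a..s} ?F = x s - x a" "integral {a..r} ?F = x r - x a"
      using int[of s] int[of r] r assms by (auto intro!: integral_unique)
    ultimately have "?F integrable_on {s..r}" "integral {s..r} ?F = (x r - x a) - (x s - x a)"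
      by (simp_all only: eq_diff_eq add.commute)
    then show ?thesis by (simp add: has_integral_iff)
  qed
  ultimately show ?thesis by (auto simp: solution_on_def)
qed

lemma solution_on_cong:
  assumes "\<And>t. t \<in> {a..b} \<Longrightarrow> x t = y t" "\<And>t. t \<in> {a..b} \<Longrightarrow> u t = u' t" "\<And>t. t \<in> {a..b} \<Longrightarrow> v t = v' t"
  shows "solution_on f g a b u v x \<longleftrightarrow> solution_on f g a b u' v' y"
proof -
  let ?F = "\<lambda>s. f s (x s) (u s) + g s (x s) (v s)" and ?G = "\<lambda>s. f s (y s) (u' s) + g s (y s) (v' s)"
  have "?F absolutely_integrable_on {a..b} \<longleftrightarrow> ?G absolutely_integrable_on {a..b}"
    using assms by (intro set_integrable_cong) auto
  moreover have "(?F has_integral (x t - x a)) {a..t} \<longleftrightarrow> (?G has_integral (y t - y a)) {a..t}"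
    if "t \<in> {a..b}" for t
  proof -
    have "x t = y t" "x a = y a" using that assms by auto
    moreover have "(?F has_integral i) {a..t} \<longleftrightarrow> (?G has_integral i) {a..t}" for i
      using that assms by (intro has_integral_cong) auto
    ultimately show ?thesis by simp
  qed
  ultimately show ?thesis by (auto simp: solution_on_def)
qed

lemma solution_on_continuous:
  assumes "solution_on f g a b u v x" "a \<le> b"
  shows "continuous_on {a..b} x"
proof -
  let ?F = "\<lambda>s. f s (x s) (u s) + g s (x s) (v s)"
  have int: "\<And>r. r \<in> {a..b} \<Longrightarrow> (?F has_integral (x r - x a)) {a..r}"
    using assms by (auto simp: solution_on_def)
  have "continuous_on {a..b} (\<lambda>t. x a + integral {a..t} ?F)"
    using int[of b] assms(2)
    by (intro continuous_intros indefinite_integral_continuous_1) (auto simp: has_integral_integrable)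
  moreover have "x a + integral {a..t} ?F = x t" if "t \<in> {a..b}" for t
    using integral_unique[OF int[OF that]] by simp
  ultimately show ?thesis
    using continuous_on_cong[of "{a..b}" "{a..b}" "\<lambda>t. x a + integral {a..t} ?F" x] by simp
qed

lemma motion_closureD:
  assumes "y \<in> motion_closure T X" "0 \<le> T" "0 < e"
  obtains x where "x \<in> X" "\<And>t. t \<in> {0..T} \<Longrightarrow> dist (y t) (x t) < e"
proof -
  let ?S = "cfunspace (top_of_set {0..T}) (euclidean_metric :: 'a metric)"
  interpret S: Metric_space "mspace ?S" "mdist ?S" by (rule Metric_space_mspace_mdist)
  have "y \<in> S.mtopology closure_of X"
    using assms(1) by (simp add: motion_closure_def mtopology_of_def)
  from this[unfolded S.metric_closure_of, THEN CollectD, THEN conjunct2, rule_format, OF \<open>0 < e\<close>]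
  obtain x where "x \<in> X" "x \<in> S.mball y e" by (rule bexE)
  from \<open>x \<in> S.mball y e\<close>[unfolded S.in_mball]
  have x: "y \<in> mspace ?S" "x \<in> mspace ?S" "mdist ?S y x < e" by (simp_all only: conj_absorb)
  have "dist (y t) (x t) < e" if "t \<in> {0..T}" for t
  proof -
    have "compactin (top_of_set {0..T}) (topspace (top_of_set {0..T}))"
      by (simp add: compactin_subtopology)
    from cfunspace_mdist_lt[OF this x, of t] have "mdist euclidean_metric (y t) (x t) < e"
      using that by simp
    then show ?thesis by simp
  qed
  with \<open>x \<in> X\<close> show thesis using that by blast
qed

text \<open>The way in which bounds on open-loop motions are carried over to their uniform limits.\<close>

lemma motion_closure_closed:
  assumes "y \<in> motion_closure T X" "t \<in> {0..T}" "closed S" "\<And>x. x \<in> X \<Longrightarrow> x t \<in> S"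
  shows "y t \<in> S"
proof -
  have "\<exists>z\<in>S. dist z (y t) < e" if "0 < e" for e
    using motion_closureD[OF assms(1) _ that] assms(2,4) by (metis atLeastAtMost_iff dist_commute order_trans)
  then have "y t \<in> closure S" by (simp add: closure_approachable)
  with assms(3) show ?thesis by simp
qed

section \<open>Bounds on motions\<close>

text \<open>The hypotheses on the dynamics with common constants for \<open>f\<close> and \<open>g\<close>, so that they are invariant
  under exchanging the players.\<close>

locale game =
  fixes T :: real and P :: "'p::metric_space set" and Q :: "'q::metric_space set"
    and f :: "real \<Rightarrow> 'x::euclidean_space \<Rightarrow> 'p \<Rightarrow> 'x" and g :: "real \<Rightarrow> 'x \<Rightarrow> 'q \<Rightarrow> 'x"
    and L K :: real
  assumes T: "0 \<le> T" and P: "compact P" "P \<noteq> {}" and Q: "compact Q" "Q \<noteq> {}"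
    and cont_f: "continuous_on ({0..T} \<times> UNIV \<times> P) (\<lambda>(t, x, u). f t x u)"
    and cont_g: "continuous_on ({0..T} \<times> UNIV \<times> Q) (\<lambda>(t, x, v). g t x v)"
    and L: "0 \<le> L" and K: "0 \<le> K"
    and lip_f: "\<And>t x y u. t \<in> {0..T} \<Longrightarrow> u \<in> P \<Longrightarrow> norm (f t x u - f t y u) \<le> L * norm (x - y)"
    and lip_g: "\<And>t x y v. t \<in> {0..T} \<Longrightarrow> v \<in> Q \<Longrightarrow> norm (g t x v - g t y v) \<le> L * norm (x - y)"
    and growth_f: "\<And>t x u. t \<in> {0..T} \<Longrightarrow> u \<in> P \<Longrightarrow> norm (f t x u) \<le> K * (1 + norm x)"
    and growth_g: "\<And>t x v. t \<in> {0..T} \<Longrightarrow> v \<in> Q \<Longrightarrow> norm (g t x v) \<le> K * (1 + norm x)"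
begin

lemma swap: "game T Q P g f L K"
  by unfold_locales (use T P Q cont_f cont_g L K lip_f lip_g growth_f growth_g in auto)

definition admissible :: "real \<Rightarrow> real \<Rightarrow> (real \<Rightarrow> 'p) \<Rightarrow> (real \<Rightarrow> 'q) \<Rightarrow> bool" where
  "admissible a b u v \<longleftrightarrow> 0 \<le> a \<and> a \<le> b \<and> b \<le> T \<and> (\<forall>t\<in>{a..b}. u t \<in> P \<and> v t \<in> Q)"

lemma admissible_subinterval:
  "admissible a b u v \<Longrightarrow> a \<le> s \<Longrightarrow> s \<le> t \<Longrightarrow> t \<le> b \<Longrightarrow> admissible s t u v"
  by (auto simp: admissible_def)

lemma rate_bound:
  assumes "t \<in> {0..T}" "u \<in> P" "v \<in> Q"
  shows "norm (f t x u + g t x v) \<le> 2 * K * (1 + norm x)"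
  using norm_triangle_ineq[of "f t x u" "g t x v"] growth_f[of t u x] growth_g[of t v x] assms by simp

lemma solution_growth:
  assumes sol: "solution_on f g a b u v x" and adm: "admissible a b u v"
  shows "1 + norm (x b) \<le> (1 + norm (x a)) * exp (2 * K * (b - a))"
proof -
  let ?F = "\<lambda>s. f s (x s) (u s) + g s (x s) (v s)"
  have ab: "a \<le> b" using adm by (auto simp: admissible_def)
  have cont: "continuous_on {a..b} (\<lambda>t. 1 + norm (x t))"
    by (intro continuous_intros solution_on_continuous[OF sol ab])
  show ?thesis
  proof (rule gronwall[OF ab _ cont])
    fix t assume t: "t \<in> {a..b}"
    have cont': "continuous_on {a..t} (\<lambda>t. 1 + norm (x t))"
      using t by (intro continuous_on_subset[OF cont]) auto
    have int: "(?F has_integral (x t - x a)) {a..t}"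
      using sol t by (auto simp: solution_on_def)
    have "norm (integral {a..t} ?F) \<le> integral {a..t} (\<lambda>s. 2 * K * (1 + norm (x s)))"
    proof (rule integral_norm_bound_integral)
      show "?F integrable_on {a..t}" using int by (auto simp: has_integral_integrable)
      show "(\<lambda>s. 2 * K * (1 + norm (x s))) integrable_on {a..t}"
        by (intro integrable_continuous_real continuous_on_mult_left cont')
      show "norm (?F s) \<le> 2 * K * (1 + norm (x s))" if "s \<in> {a..t}" for s
        using that t adm by (intro rate_bound) (auto simp: admissible_def)
    qed
    then have "norm (x t - x a) \<le> 2 * K * integral {a..t} (\<lambda>s. 1 + norm (x s))"
      using integral_unique[OF int] by simp
    then show "1 + norm (x t) \<le> (1 + norm (x a)) + 2 * K * integral {a..t} (\<lambda>s. 1 + norm (x s))"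
      using norm_triangle_ineq2[of "x t" "x a"] by linarith
  qed (use K in auto)
qed

lemma solution_displacement:
  assumes sol: "solution_on f g a b u v x" and adm: "admissible a b u v"
    and R: "\<And>s. s \<in> {a..b} \<Longrightarrow> 1 + norm (x s) \<le> R"
  shows "norm (x b - x a) \<le> 2 * K * R * (b - a)"
proof -
  have ab: "a \<le> b" using adm by (auto simp: admissible_def)
  have "0 \<le> R" using R[of a] ab norm_ge_zero[of "x a"] by (smt (verit) atLeastAtMost_iff)
  have "norm (x b - x a) \<le> 2 * K * R * measure lborel {a..b}"
  proof (rule has_integral_bound_real[where S = "{}"])
    show "((\<lambda>s. f s (x s) (u s) + g s (x s) (v s)) has_integral (x b - x a)) {a..b}"
      using sol ab by (auto simp: solution_on_def)
    fix s assume s: "s \<in> {a..b} - {}"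
    have "norm (f s (x s) (u s) + g s (x s) (v s)) \<le> 2 * K * (1 + norm (x s))"
      using adm s by (intro rate_bound) (auto simp: admissible_def)
    also have "\<dots> \<le> 2 * K * R"
      using R[of s] s K by (intro mult_left_mono) auto
    finally show "norm (f s (x s) (u s) + g s (x s) (v s)) \<le> 2 * K * R" .
  qed (use K \<open>0 \<le> R\<close> in auto)
  then show ?thesis using ab by simp
qed

text \<open>On a short interval the Picard operator is a contraction of the bounded continuous functions; these
  live on the whole line, so the operator is extended beyond \<open>{a..b}\<close> by clamping the time.\<close>

lemma constant_control_solution_exists:
  assumes "0 \<le> a" "a \<le> b" "b \<le> T" "u \<in> P" "v \<in> Q" and short: "2 * L * (b - a) < 1"
  obtains x where "x a = x\<^sub>0" "solution_on f g a b (\<lambda>_. u) (\<lambda>_. v) x"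
proof -
  define F where "F s x = f s x u + g s x v" for s x
  have contF: "continuous_on ({a..b} \<times> UNIV) (\<lambda>(s, x). F s x)"
  proof -
    have "continuous_on ({a..b} \<times> UNIV) (\<lambda>p. f (fst p) (snd p) u)"
      using assms by (intro continuous_on_compose2[OF cont_f, of _ "\<lambda>p. (fst p, snd p, u)", simplified])
        (auto intro!: continuous_intros)
    moreover have "continuous_on ({a..b} \<times> UNIV) (\<lambda>p. g (fst p) (snd p) v)"
      using assms by (intro continuous_on_compose2[OF cont_g, of _ "\<lambda>p. (fst p, snd p, v)", simplified])
        (auto intro!: continuous_intros)
    ultimately show ?thesis
      by (auto simp: F_def case_prod_unfold intro!: continuous_intros)
  qed
  have cont: "continuous_on {a..b} (\<lambda>s. F s (y s))" if "continuous_on {a..b} y" for y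
  proof -
    have "continuous_on {a..b} (\<lambda>s. (s, y s))" by (intro continuous_intros that)
    then show ?thesis using continuous_on_compose2[OF contF, of "{a..b}" "\<lambda>s. (s, y s)"] by auto
  qed
  define \<Phi> where "\<Phi> y t = x\<^sub>0 + integral {a..t} (\<lambda>s. F s (y s))" for y t
  define N :: "(real \<Rightarrow>\<^sub>C 'x) \<Rightarrow> (real \<Rightarrow>\<^sub>C 'x)" where "N y = Bcontfun (\<lambda>t. \<Phi> y (clamp a b t))" for y
  have N: "apply_bcontfun (N y) t = \<Phi> y (clamp a b t)" for y t
  proof -
    have c: "continuous_on {a..b} (\<Phi> y)"
      unfolding \<Phi>_def
      by (intro continuous_intros indefinite_integral_continuous_1 integrable_continuous_real cont) auto
    have "(\<lambda>t. \<Phi> y (clamp a b t)) \<in> bcontfun"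
      using c compact_imp_bounded[OF compact_continuous_image[OF c]]
      by (auto simp: bcontfun_def intro!: clamp_continuous_on clamp_bounded)
    then show ?thesis by (simp add: N_def Bcontfun_inverse)
  qed
  have "\<exists>!y. N y = y"
  proof (rule banach_fix_type)
    show "\<forall>y z. dist (N y) (N z) \<le> 2 * L * (b - a) * dist y z"
    proof (intro allI dist_bound)
      fix y z :: "real \<Rightarrow>\<^sub>C 'x" and t
      have t: "clamp a b t \<in> {a..b}"
        using clamp_in_interval[of a b t] assms by simp
      have int: "(\<lambda>s. F s (w s)) integrable_on {a..clamp a b t}" for w :: "real \<Rightarrow>\<^sub>C 'x"
        using t by (intro integrable_continuous_real continuous_on_subset[OF cont]) auto
      have "norm (\<Phi> y (clamp a b t) - \<Phi> z (clamp a b t)) \<le> 2 * L * dist y z * measure lborel {a..clamp a b t}"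
      proof (rule has_integral_bound_real[where S = "{}"])
        show "((\<lambda>s. F s (y s) - F s (z s)) has_integral (\<Phi> y (clamp a b t) - \<Phi> z (clamp a b t))) {a..clamp a b t}"
          using has_integral_diff[OF integrable_integral[OF int[of y]] integrable_integral[OF int[of z]]]
          by (simp add: \<Phi>_def)
        fix s assume s: "s \<in> {a..clamp a b t} - {}"
        have "norm (F s (y s) - F s (z s)) \<le> norm (f s (y s) u - f s (z s) u) + norm (g s (y s) v - g s (z s) v)"
          unfolding F_def by (rule norm_diff_triangle_ineq)
        also have "\<dots> \<le> L * norm (y s - z s) + L * norm (y s - z s)"
          using s t assms by (intro add_mono lip_f lip_g) auto
        also have "\<dots> \<le> 2 * L * dist y z"
          using mult_left_mono[OF dist_bounded[of y s z], of "2 * L"] L by (simp add: dist_norm)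
        finally show "norm (F s (y s) - F s (z s)) \<le> 2 * L * dist y z" .
      qed (use L in auto)
      also have "\<dots> \<le> 2 * L * dist y z * (b - a)"
        using t L by (intro mult_left_mono) auto
      finally have "dist (N y t) (N z t) \<le> 2 * L * dist y z * (b - a)"
        by (simp only: N dist_norm[of "\<Phi> _ _"])
      then show "dist (N y t) (N z t) \<le> 2 * L * (b - a) * dist y z"
        by (simp only: mult_ac)
    qed
  qed (use short L assms in auto)
  then obtain y where "N y = y" by blast
  then have y: "y t = \<Phi> y t" if "t \<in> {a..b}" for t
    using N[of y t] that by simp
  have F: "continuous_on {a..b} (\<lambda>s. F s (y s))" by (intro cont) auto
  have "((\<lambda>s. F s (y s)) has_integral (y t - y a)) {a..t}" if "t \<in> {a..b}" for t
  proof -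
    have "(\<lambda>s. F s (y s)) integrable_on {a..t}"
      using that by (intro integrable_continuous_real continuous_on_subset[OF F]) auto
    then show ?thesis using y[of t] y[of a] that by (simp add: \<Phi>_def has_integral_integral)
  qed
  then have "solution_on f g a b (\<lambda>_. u) (\<lambda>_. v) y"
    using absolutely_integrable_continuous_real[OF F] by (auto simp: solution_on_def F_def)
  moreover have "y a = x\<^sub>0" using y[of a] assms by (simp add: \<Phi>_def)
  ultimately show thesis using that by blast
qed

end

section \<open>Extremal shift\<close>

text \<open>The bound \<open>R\<close> dominates \<open>1 + norm x\<close> at all later times for motions that start at some \<open>(t\<^sub>0, x\<^sub>0)\<close> with
  \<open>norm x\<^sub>0 \<le> R\<^sub>0\<close>, and \<open>M\<close> dominates their speed. Only a modulus of continuity in time is needed, as the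
  dependence on the state is controlled by \<open>L\<close>.\<close>

locale bounded_game = game T P Q f g L K
  for T :: real and P :: "'p::metric_space set" and Q :: "'q::metric_space set"
    and f :: "real \<Rightarrow> 'x::euclidean_space \<Rightarrow> 'p \<Rightarrow> 'x" and g :: "real \<Rightarrow> 'x \<Rightarrow> 'q \<Rightarrow> 'x"
    and L K :: real +
  fixes R\<^sub>0 R M :: real and \<omega> :: "real \<Rightarrow> real"
  assumes R\<^sub>0: "0 \<le> R\<^sub>0" and R: "R = (1 + R\<^sub>0) * exp (2 * K * T)" and M: "M = 2 * K * R"
    and \<omega>_nonneg: "\<And>h. 0 \<le> h \<Longrightarrow> 0 \<le> \<omega> h" and \<omega>_mono: "\<And>h h'. 0 \<le> h \<Longrightarrow> h \<le> h' \<Longrightarrow> \<omega> h \<le> \<omega> h'"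
    and \<omega>_lim: "(\<omega> \<longlongrightarrow> 0) (at_right 0)"
    and \<omega>_f: "\<And>s t x u h. s \<in> {0..T} \<Longrightarrow> t \<in> {0..T} \<Longrightarrow> norm x \<le> R \<Longrightarrow> u \<in> P \<Longrightarrow> \<bar>s - t\<bar> \<le> h \<Longrightarrow>
      norm (f s x u - f t x u) \<le> \<omega> h"
    and \<omega>_g: "\<And>s t x v h. s \<in> {0..T} \<Longrightarrow> t \<in> {0..T} \<Longrightarrow> norm x \<le> R \<Longrightarrow> v \<in> Q \<Longrightarrow> \<bar>s - t\<bar> \<le> h \<Longrightarrow>
      norm (g s x v - g t x v) \<le> \<omega> h"
begin

lemma swap_bounded: "bounded_game T Q P g f L K R\<^sub>0 R M \<omega>"
  by (intro bounded_game.intro swap bounded_game_axioms.intro)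
     (fact R\<^sub>0 R M \<omega>_nonneg \<omega>_mono \<omega>_lim \<omega>_f \<omega>_g)+

text \<open>The a priori bound at time \<open>t\<close>. It is stable under concatenation of motions, which a constant bound
  would not be; the guide is such a concatenation.\<close>

definition reach :: "real \<Rightarrow> 'x \<Rightarrow> bool" where
  "reach t x \<longleftrightarrow> 1 + norm x \<le> (1 + R\<^sub>0) * exp (2 * K * t)"

text \<open>The local error of \<open>extremal_shift\<close>: the first summand comes from freezing time and state at the
  left end of the step, the second from the square of the displacement.\<close>

definition \<kappa> :: "real \<Rightarrow> real" where
  "\<kappa> h = 16 * R * (L * M * h + \<omega> h) + 4 * M\<^sup>2 * h"

definition drift :: real where
  "drift = 8 * M * R + 4 * M\<^sup>2 * T"

lemma R_pos: "0 < R" and M_nonneg: "0 \<le> M"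
  using R\<^sub>0 K by (auto simp: R M)

lemma \<kappa>_nonneg: "0 \<le> h \<Longrightarrow> 0 \<le> \<kappa> h"
  using R_pos M_nonneg L \<omega>_nonneg[of h] by (simp add: \<kappa>_def)

lemma \<kappa>_mono: "0 \<le> h \<Longrightarrow> h \<le> h' \<Longrightarrow> \<kappa> h \<le> \<kappa> h'"
  unfolding \<kappa>_def using R_pos M_nonneg L \<omega>_mono[of h h']
  by (intro add_mono mult_left_mono) auto

lemma \<kappa>_lim: "(\<kappa> \<longlongrightarrow> 0) (at_right 0)"
  unfolding \<kappa>_def by (rule tendsto_eq_intros \<omega>_lim refl | simp)+

lemma reach_bound: "reach t x \<Longrightarrow> t \<le> T \<Longrightarrow> 1 + norm x \<le> R"
  unfolding reach_def R using R\<^sub>0 K by (smt (verit) exp_le_cancel_iff mult_left_mono mult_nonneg_nonneg)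

lemma reach_solution:
  assumes sol: "solution_on f g a b u v x" and adm: "admissible a b u v" and "reach a (x a)"
    and t: "t \<in> {a..b}"
  shows "reach t (x t)"
proof -
  have "1 + norm (x t) \<le> (1 + norm (x a)) * exp (2 * K * (t - a))"
  proof (rule solution_growth)
    show "solution_on f g a t u v x" "admissible a t u v"
      using t by (auto intro!: solution_on_subinterval[OF sol] admissible_subinterval[OF adm])
  qed
  also have "\<dots> \<le> (1 + R\<^sub>0) * exp (2 * K * a) * exp (2 * K * (t - a))"
    using assms(3) by (intro mult_right_mono) (auto simp: reach_def)
  also have "\<dots> = (1 + R\<^sub>0) * exp (2 * K * t)"
    by (simp add: mult.assoc flip: exp_add) (simp add: algebra_simps)
  finally show ?thesis by (simp add: reach_def)
qed

lemma displacement_reach: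
  assumes sol: "solution_on f g a b u v x" and adm: "admissible a b u v" and re: "reach a (x a)"
    and t: "t \<in> {a..b}"
  shows "norm (x t - x a) \<le> M * (b - a)"
proof -
  have "norm (x t - x a) \<le> 2 * K * R * (t - a)"
  proof (rule solution_displacement)
    show "solution_on f g a t u v x" "admissible a t u v"
      using t by (auto intro!: solution_on_subinterval[OF sol] admissible_subinterval[OF adm])
    show "1 + norm (x s) \<le> R" if "s \<in> {a..t}" for s
      using that t adm reach_solution[OF sol adm re, of s] reach_bound by (auto simp: admissible_def)
  qed
  also have "\<dots> \<le> M * (b - a)"
    using t M_nonneg unfolding M[symmetric] by (intro mult_left_mono) auto
  finally show ?thesis .
qed

text \<open>Without any relation between the controls, the distance grows at most by the displacement of both
  motions. This covers the cooperative steps in which the opponent deviates.\<close>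

lemma distance_growth:
  assumes x: "solution_on f g a b u v x" "admissible a b u v" "reach a (x a)"
    and w: "solution_on f g a b u' v' w" "admissible a b u' v'" "reach a (w a)"
  shows "(norm (w b - x b))\<^sup>2 \<le> (norm (w a - x a))\<^sup>2 + drift * (b - a)"
proof -
  define h where "h = b - a"
  have ab: "0 \<le> h" "h \<le> T" "a \<le> b" "a \<le> T" using x(2) by (auto simp: admissible_def h_def)
  have "norm (x b - x a) \<le> M * h" "norm (w b - w a) \<le> M * h"
    using displacement_reach[OF x, of b] displacement_reach[OF w, of b] ab by (auto simp: h_def)
  moreover have "norm (w b - x b) \<le> norm (w a - x a) + norm ((w b - w a) - (x b - x a))"
    using norm_triangle_ineq[of "w a - x a" "(w b - w a) - (x b - x a)"] by simp
  ultimately have "norm (w b - x b) \<le> norm (w a - x a) + 2 * M * h"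
    using norm_triangle_ineq4[of "w b - w a" "x b - x a"] by linarith
  then have "(norm (w b - x b))\<^sup>2 \<le> (norm (w a - x a) + 2 * M * h)\<^sup>2"
    by (intro power_mono) auto
  also have "\<dots> = (norm (w a - x a))\<^sup>2 + (4 * M * norm (w a - x a) + 4 * M\<^sup>2 * h) * h"
    by (simp add: power2_eq_square algebra_simps)
  also have "\<dots> \<le> (norm (w a - x a))\<^sup>2 + (4 * M * (2 * R) + 4 * M\<^sup>2 * T) * h"
    using norm_triangle_ineq4[of "w a" "x a"] reach_bound[OF x(3)] reach_bound[OF w(3)] ab M_nonneg
    by (intro add_left_mono mult_right_mono add_mono mult_left_mono) auto
  finally show ?thesis by (simp add: h_def drift_def mult_ac)
qed

text \<open>Expand \<open>(norm (w b - x b))\<^sup>2\<close> around the left end. The cross term is the integral of the inner product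
  of \<open>w a - x a\<close> with the difference of the velocities. Once these are frozen at time \<open>a\<close> and state \<open>x a\<close>,
  that product is nonpositive by hypothesis; freezing the state of \<open>w\<close> at \<open>x a\<close> instead of
  \<open>w a\<close> costs \<open>L * norm (w a - x a)\<close>, which produces the factor \<open>1 + 4 L (b - a)\<close>.\<close>

lemma extremal_shift:
  assumes x: "solution_on f g a b u v x" "admissible a b u v" "reach a (x a)"
    and w: "solution_on f g a b u' v' w" "admissible a b u' v'" "reach a (w a)"
    and extremal: "\<And>s. s \<in> {a..b} \<Longrightarrow> (w a - x a) \<bullet> (f a (x a) (u' s) + g a (x a) (v' s)) \<le>
      (w a - x a) \<bullet> (f a (x a) (u s) + g a (x a) (v s))"
  shows "(norm (w b - x b))\<^sup>2 \<le> (1 + 4 * L * (b - a)) * (norm (w a - x a))\<^sup>2 + (b - a) * \<kappa> (b - a)"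
proof -
  define h where "h = b - a"
  define s\<^sub>0 where "s\<^sub>0 = w a - x a"
  define \<Delta> where "\<Delta> = (w b - w a) - (x b - x a)"
  define m where "m = L * M * h + \<omega> h"
  let ?X = "\<lambda>s. f s (x s) (u s) + g s (x s) (v s)" and ?W = "\<lambda>s. f s (w s) (u' s) + g s (w s) (v' s)"
  have ab: "0 \<le> h" "0 \<le> a" "a \<le> b" "b \<le> T" using x(2) by (auto simp: admissible_def h_def)
  have m: "0 \<le> m" using L M_nonneg \<omega>_nonneg[of h] ab by (simp add: m_def)
  have s\<^sub>0: "norm s\<^sub>0 \<le> 2 * R"
    using norm_triangle_ineq4[of "w a" "x a"] reach_bound[OF x(3)] reach_bound[OF w(3)] ab
    by (auto simp: s\<^sub>0_def)
  have \<Delta>: "norm \<Delta> \<le> 2 * M * h"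
    using displacement_reach[OF x, of b] displacement_reach[OF w, of b] ab
      norm_triangle_ineq4[of "w b - w a" "x b - x a"] by (auto simp: h_def \<Delta>_def)
  have near: "norm (f s y p - f a (x a) p) \<le> L * norm (y - x a) + \<omega> h"
    "norm (g s y q - g a (x a) q) \<le> L * norm (y - x a) + \<omega> h"
    if "s \<in> {a..b}" "p \<in> P" "q \<in> Q" for s y p q
  proof -
    have s: "s \<in> {0..T}" "a \<in> {0..T}" "norm (x a) \<le> R" "\<bar>s - a\<bar> \<le> h"
      using that ab reach_bound[OF x(3)] by (auto simp: h_def)
    show "norm (f s y p - f a (x a) p) \<le> L * norm (y - x a) + \<omega> h"
      using lip_f[OF s(1) that(2), of y "x a"] \<omega>_f[OF s(1-3) that(2) s(4)]
        norm_triangle_ineq[of "f s y p - f s (x a) p" "f s (x a) p - f a (x a) p"] by simp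
    show "norm (g s y q - g a (x a) q) \<le> L * norm (y - x a) + \<omega> h"
      using lip_g[OF s(1) that(3), of y "x a"] \<omega>_g[OF s(1-3) that(3) s(4)]
        norm_triangle_ineq[of "g s y q - g s (x a) q" "g s (x a) q - g a (x a) q"] by simp
  qed
  have pointwise: "s\<^sub>0 \<bullet> (?W s - ?X s) \<le> norm s\<^sub>0 * (2 * L * norm s\<^sub>0 + 4 * m)" if s: "s \<in> {a..b}" for s
  proof -
    have c: "u s \<in> P" "v s \<in> Q" "u' s \<in> P" "v' s \<in> Q"
      using x(2) w(2) s by (auto simp: admissible_def)
    \<comment> \<open>The error of freezing the four velocities at time \<open>a\<close> and state \<open>x a\<close>.\<close>
    define \<rho> where "\<rho> = (f s (w s) (u' s) - f a (x a) (u' s)) + (g s (w s) (v' s) - g a (x a) (v' s))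
      - (f s (x s) (u s) - f a (x a) (u s)) - (g s (x s) (v s) - g a (x a) (v s))"
    have "norm (x s - x a) \<le> M * h" "norm (w s - w a) \<le> M * h"
      using displacement_reach[OF x s] displacement_reach[OF w s] by (auto simp: h_def)
    moreover have "norm (w s - x a) \<le> norm (w s - w a) + norm s\<^sub>0"
      using norm_triangle_ineq[of "w s - w a" s\<^sub>0] by (simp add: s\<^sub>0_def)
    ultimately have "norm (x s - x a) \<le> M * h" "norm (w s - x a) \<le> M * h + norm s\<^sub>0" by auto
    then have le: "L * norm (x s - x a) \<le> L * M * h" "L * norm (w s - x a) \<le> L * M * h + L * norm s\<^sub>0"
      using L by (auto simp: mult.assoc simp flip: distrib_left intro!: mult_left_mono)
    have "norm \<rho> \<le> norm (f s (w s) (u' s) - f a (x a) (u' s)) + norm (g s (w s) (v' s) - g a (x a) (v' s))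
      + norm (f s (x s) (u s) - f a (x a) (u s)) + norm (g s (x s) (v s) - g a (x a) (v s))"
      unfolding \<rho>_def
      by (intro order_trans[OF norm_triangle_ineq4] add_mono order_refl norm_triangle_ineq)
    also have "\<dots> \<le> 2 * L * norm s\<^sub>0 + 4 * m"
      using near(1)[OF s c(3,4), of "w s"] near(2)[OF s c(3,4), of "w s"]
        near(1)[OF s c(1,2), of "x s"] near(2)[OF s c(1,2), of "x s"] le
      by (simp add: m_def)
    finally have \<rho>: "norm \<rho> \<le> 2 * L * norm s\<^sub>0 + 4 * m" .
    have "s\<^sub>0 \<bullet> (?W s - ?X s) = s\<^sub>0 \<bullet> (f a (x a) (u' s) + g a (x a) (v' s))
        - s\<^sub>0 \<bullet> (f a (x a) (u s) + g a (x a) (v s)) + s\<^sub>0 \<bullet> \<rho>"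
      by (simp add: \<rho>_def inner_diff_right inner_add_right)
    also have "\<dots> \<le> s\<^sub>0 \<bullet> \<rho>"
      using extremal[OF s] by (simp add: s\<^sub>0_def)
    also have "\<dots> \<le> norm s\<^sub>0 * norm \<rho>" by (rule norm_cauchy_schwarz)
    also have "\<dots> \<le> norm s\<^sub>0 * (2 * L * norm s\<^sub>0 + 4 * m)"
      using \<rho> by (intro mult_left_mono) auto
    finally show ?thesis .
  qed
  have "((\<lambda>s. ?W s - ?X s) has_integral \<Delta>) {a..b}"
    unfolding \<Delta>_def using x(1) w(1) ab by (intro has_integral_diff) (auto simp: solution_on_def)
  then have "((\<lambda>s. s\<^sub>0 \<bullet> (?W s - ?X s)) has_integral s\<^sub>0 \<bullet> \<Delta>) {a..b}"
    using has_integral_linear[OF _ bounded_linear_inner_right[of s\<^sub>0]] by (simp add: o_def)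
  moreover have "((\<lambda>s. norm s\<^sub>0 * (2 * L * norm s\<^sub>0 + 4 * m)) has_integral
      h * (norm s\<^sub>0 * (2 * L * norm s\<^sub>0 + 4 * m))) {a..b}"
    using has_integral_const_real[of "norm s\<^sub>0 * (2 * L * norm s\<^sub>0 + 4 * m)" a b] ab by (simp add: h_def)
  ultimately have "s\<^sub>0 \<bullet> \<Delta> \<le> h * (norm s\<^sub>0 * (2 * L * norm s\<^sub>0 + 4 * m))"
    using pointwise by (rule has_integral_le)
  also have "\<dots> = 2 * L * h * (norm s\<^sub>0)\<^sup>2 + h * (4 * (norm s\<^sub>0 * m))"
    by (simp add: power2_eq_square algebra_simps)
  also have "\<dots> \<le> 2 * L * h * (norm s\<^sub>0)\<^sup>2 + h * (4 * (2 * R * m))"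
    using s\<^sub>0 m ab by (intro add_left_mono mult_left_mono mult_right_mono) auto
  finally have "s\<^sub>0 \<bullet> \<Delta> \<le> 2 * L * h * (norm s\<^sub>0)\<^sup>2 + h * (8 * R * m)" by simp
  moreover have "(norm \<Delta>)\<^sup>2 \<le> h * (4 * M\<^sup>2 * h)"
    using power_mono[OF \<Delta>, of 2] by (simp add: power2_eq_square mult_ac)
  moreover have "w b - x b = s\<^sub>0 + \<Delta>" by (simp add: s\<^sub>0_def \<Delta>_def)
  then have "(norm (w b - x b))\<^sup>2 = (norm s\<^sub>0)\<^sup>2 + 2 * (s\<^sub>0 \<bullet> \<Delta>) + (norm \<Delta>)\<^sup>2"
    by (simp add: power2_norm_eq_inner inner_add_left inner_add_right inner_commute)
  moreover have "\<kappa> h = 16 * R * m + 4 * M\<^sup>2 * h" by (simp add: \<kappa>_def m_def)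
  ultimately have "(norm (w b - x b))\<^sup>2 \<le> (1 + 4 * L * h) * (norm s\<^sub>0)\<^sup>2 + h * \<kappa> h"
    by (simp add: algebra_simps)
  then show ?thesis by (simp add: h_def s\<^sub>0_def)
qed

end

section \<open>Partitions\<close>

lemma partition_of_le:
  assumes "partition_of a b r \<tau>" "j \<le> k" "k \<le> r"
  shows "\<tau> j \<le> \<tau> k"
  using assms(2,3)
proof (induction k rule: dec_induct)
  case (step k)
  then show ?case using assms(1) by (auto simp: partition_of_def dest!: spec[of _ k])
qed simp

lemma partition_of_bounds:
  assumes "partition_of a b r \<tau>" "k \<le> r"
  shows "a \<le> \<tau> k" "\<tau> k \<le> b"
  using partition_of_le[OF assms(1), of 0 k] partition_of_le[OF assms(1), of k r] assms
  by (auto simp: partition_of_def)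

lemma step_le_mesh: "k < r \<Longrightarrow> \<tau> (Suc k) - \<tau> k \<le> mesh r \<tau>"
  unfolding mesh_def by (rule Max_ge) auto

section \<open>Strategies following a guide\<close>

definition basis_enum :: "nat \<Rightarrow> 'x::euclidean_space" where
  "basis_enum = (SOME e. bij_betw e {..<DIM('x)} Basis)"

text \<open>The guide variable: coordinate \<open>0\<close> holds the tolerance, the next \<open>DIM('x)\<close> coordinates the position.\<close>

definition encode :: "'x::euclidean_space \<Rightarrow> real \<Rightarrow> nat \<Rightarrow> real" where
  "encode w \<theta> i = (case i of 0 \<Rightarrow> \<theta> | Suc j \<Rightarrow> if j < DIM('x) then w \<bullet> basis_enum j else 0)"

definition position :: "(nat \<Rightarrow> real) \<Rightarrow> 'x::euclidean_space" where
  "position W = (\<Sum>j<DIM('x). W (Suc j) *\<^sub>R basis_enum j)"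

definition tolerance :: "(nat \<Rightarrow> real) \<Rightarrow> real" where
  "tolerance W = W 0"

lemma tolerance_encode [simp]: "tolerance (encode w \<theta>) = \<theta>"
  by (simp add: tolerance_def encode_def)

lemma position_encode [simp]: "position (encode w \<theta>) = (w :: 'x::euclidean_space)"
proof -
  have "\<exists>e. bij_betw e {..<DIM('x)} (Basis :: 'x set)"
    using ex_bij_betw_nat_finite[of "Basis :: 'x set"] by (simp add: atLeast0LessThan)
  then have bij: "bij_betw basis_enum {..<DIM('x)} (Basis :: 'x set)"
    unfolding basis_enum_def by (rule someI_ex)
  have "position (encode w \<theta>) = (\<Sum>j<DIM('x). (w \<bullet> basis_enum j) *\<^sub>R (basis_enum j :: 'x))"
    by (simp add: position_def encode_def)
  also have "\<dots> = (\<Sum>b\<in>Basis. (w \<bullet> b) *\<^sub>R b)"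
    by (rule sum.reindex_bij_betw[OF bij])
  finally show ?thesis by (simp add: euclidean_representation)
qed

lemma encode_in_Euclidean_space: "encode (w :: 'x::euclidean_space) \<theta> \<in> topspace (Euclidean_space (Suc DIM('x)))"
  by (auto simp: topspace_Euclidean_space encode_def split: nat.split)

text \<open>The control is the extremal shift towards the position of the guide. The guide makes a cooperative
  step while the state is within its tolerance and a punishing step otherwise.\<close>

definition shift_strategy ::
  "'p set \<Rightarrow> (real \<Rightarrow> 'x::euclidean_space \<Rightarrow> 'p \<Rightarrow> 'x) \<Rightarrow> (real \<Rightarrow> real \<Rightarrow> real) \<Rightarrow>
   (real \<Rightarrow> 'x \<Rightarrow> real \<Rightarrow> 'x) \<Rightarrow> (real \<Rightarrow> 'x \<Rightarrow> 'x \<Rightarrow> real \<Rightarrow> 'x) \<Rightarrow> ('x, 'p) guide_strategy" where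
  "shift_strategy P f inflate coop pun =
    \<lparr>control = (\<lambda>t x W. SOME u. u \<in> P \<and> (\<forall>u'\<in>P. (position W - x) \<bullet> f t x u' \<le> (position W - x) \<bullet> f t x u)),
     guide_step = (\<lambda>t' t x W. encode
       (if (norm (position W - x))\<^sup>2 \<le> tolerance W then coop t (position W) t' else pun t (position W) x t')
       (inflate (t' - t) (tolerance W))),
     guide_init = (\<lambda>t x. encode x 0)\<rparr>"

lemma guide_shift_strategy_Suc:
  fixes U :: "('x::euclidean_space, 'p) guide_strategy"
  assumes "U = shift_strategy P f inflate coop pun"
    and "w = position (guide U \<tau> x k)" "\<theta> = tolerance (guide U \<tau> x k)"
  shows "guide U \<tau> x (Suc k) = encode
    (if (norm (w - x (\<tau> k)))\<^sup>2 \<le> \<theta> then coop (\<tau> k) w (\<tau> (Suc k)) else pun (\<tau> k) w (x (\<tau> k)) (\<tau> (Suc k)))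
    (inflate (\<tau> (Suc k) - \<tau> k) \<theta>)"
  using assms by (simp add: shift_strategy_def)

context game
begin

lemma extremal_control:
  assumes "t \<in> {0..T}"
  obtains u where "u \<in> P" "\<And>u'. u' \<in> P \<Longrightarrow> s \<bullet> f t x u' \<le> s \<bullet> f t x u"
proof -
  have "continuous_on P (\<lambda>u. (t, x, u))" by (intro continuous_intros)
  moreover have "(\<lambda>u. (t, x, u)) ` P \<subseteq> {0..T} \<times> UNIV \<times> P" using assms by auto
  ultimately have "continuous_on P (f t x)"
    using continuous_on_compose2[OF cont_f] by fastforce
  then have "continuous_on P (\<lambda>u. s \<bullet> f t x u)" by (intro continuous_intros)
  from continuous_attains_sup[OF P this] that show thesis by blast
qed

lemma control_shift_strategy:
  assumes "t \<in> {0..T}" and u: "u = control (shift_strategy P f inflate coop pun) t x W"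
  shows "u \<in> P" "u' \<in> P \<Longrightarrow> (position W - x) \<bullet> f t x u' \<le> (position W - x) \<bullet> f t x u"
proof -
  have "\<exists>u. u \<in> P \<and> (\<forall>u'\<in>P. (position W - x) \<bullet> f t x u' \<le> (position W - x) \<bullet> f t x u)"
    using extremal_control[OF assms(1)] by metis
  from someI_ex[OF this]
  show "u \<in> P" "u' \<in> P \<Longrightarrow> (position W - x) \<bullet> f t x u' \<le> (position W - x) \<bullet> f t x u"
    by (simp_all add: u shift_strategy_def)
qed

lemma is_guide_strategy_shift_strategy: "is_guide_strategy T P (shift_strategy P f inflate coop pun)"
  unfolding is_guide_strategy_def
  by (rule exI[of _ "Suc DIM('x)"])
     (use control_shift_strategy(1) in \<open>auto simp: shift_strategy_def encode_in_Euclidean_space\<close>)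

definition cooperative :: "(real \<Rightarrow> 'x \<Rightarrow> real) \<Rightarrow> (real \<Rightarrow> 'x \<Rightarrow> real \<Rightarrow> 'x) \<Rightarrow> bool" where
  "cooperative c coop \<longleftrightarrow> (\<forall>t\<in>{0..T}. \<forall>w. coop t w \<in> Sol T f g P Q t w \<and>
     (\<forall>s\<in>{t..T}. c s (coop t w s) = c t w))"

text \<open>The control \<open>v\<close> is the one of player II that is least favourable for moving from \<open>x\<close> towards \<open>w\<close>. The
  real player II can thus only do better in this direction than the one who moves the guide.\<close>

definition punishing :: "(real \<Rightarrow> 'x \<Rightarrow> real) \<Rightarrow> (real \<Rightarrow> 'x \<Rightarrow> 'x \<Rightarrow> real \<Rightarrow> 'x) \<Rightarrow> bool" where
  "punishing c pun \<longleftrightarrow> (\<forall>t\<in>{0..T}. \<forall>w x. \<exists>v\<in>Q. (\<forall>v'\<in>Q. (w - x) \<bullet> g t x v \<le> (w - x) \<bullet> g t x v') \<and>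
     pun t w x \<in> Sol1 T f g P t w v \<and> (\<forall>s\<in>{t..T}. c s (pun t w x s) \<le> c t w))"

text \<open>One choice has to serve both payoff functions, since both players must compute the same guide.\<close>

lemma cooperative_exists:
  assumes "\<And>t w. t \<in> {0..T} \<Longrightarrow>
    \<exists>y\<in>Sol T f g P Q t w. \<forall>s\<in>{t..T}. c s (y s) = c t w \<and> c' s (y s) = c' t w"
  obtains coop where "cooperative c coop" "cooperative c' coop"
proof -
  from assms have "\<forall>t w. \<exists>y. t \<in> {0..T} \<longrightarrow>
    y \<in> Sol T f g P Q t w \<and> (\<forall>s\<in>{t..T}. c s (y s) = c t w \<and> c' s (y s) = c' t w)" by blast
  then obtain coop where "\<And>t w. t \<in> {0..T} \<Longrightarrow> coop t w \<in> Sol T f g P Q t w \<and>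
    (\<forall>s\<in>{t..T}. c s (coop t w s) = c t w \<and> c' s (coop t w s) = c' t w)" by metis
  then show thesis by (intro that[of coop]) (auto simp: cooperative_def)
qed

lemma punishing_exists:
  assumes "\<And>t w v. t \<in> {0..T} \<Longrightarrow> v \<in> Q \<Longrightarrow>
    \<exists>y\<in>Sol1 T f g P t w v. \<forall>s\<in>{t..T}. c s (y s) \<le> c t w"
  obtains pun where "punishing c pun"
proof -
  have "\<forall>t w x. \<exists>y. t \<in> {0..T} \<longrightarrow> (\<exists>v\<in>Q. (\<forall>v'\<in>Q. (w - x) \<bullet> g t x v \<le> (w - x) \<bullet> g t x v') \<and>
     y \<in> Sol1 T f g P t w v \<and> (\<forall>s\<in>{t..T}. c s (y s) \<le> c t w))"
  proof (intro allI)
    fix t w x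
    show "\<exists>y. t \<in> {0..T} \<longrightarrow> (\<exists>v\<in>Q. (\<forall>v'\<in>Q. (w - x) \<bullet> g t x v \<le> (w - x) \<bullet> g t x v') \<and>
     y \<in> Sol1 T f g P t w v \<and> (\<forall>s\<in>{t..T}. c s (y s) \<le> c t w))"
    proof (cases "t \<in> {0..T}")
      case True
      interpret S: game T Q P g f L K by (rule swap)
      obtain v where v: "v \<in> Q" "\<And>v'. v' \<in> Q \<Longrightarrow> - (w - x) \<bullet> g t x v' \<le> - (w - x) \<bullet> g t x v"
        using S.extremal_control[OF True] by blast
      then have "\<forall>v'\<in>Q. (w - x) \<bullet> g t x v \<le> (w - x) \<bullet> g t x v'"
        unfolding inner_minus_left by simp
      with assms[OF True v(1), of w] v(1) show ?thesis by blast
    qed auto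
  qed
  then obtain pun where "\<And>t w x. t \<in> {0..T} \<Longrightarrow> (\<exists>v\<in>Q. (\<forall>v'\<in>Q. (w - x) \<bullet> g t x v \<le> (w - x) \<bullet> g t x v') \<and>
     pun t w x \<in> Sol1 T f g P t w v \<and> (\<forall>s\<in>{t..T}. c s (pun t w x s) \<le> c t w))" by metis
  then show thesis by (intro that[of pun]) (auto simp: punishing_def)
qed

end

section \<open>One step of the guide\<close>

context bounded_game
begin

text \<open>The estimates for two motions remain true when the second is a limit of open-loop motions, since they
  do not depend on the controls and the sets of points that satisfy them are closed.\<close>

lemma guide_motion_step:
  assumes y: "y \<in> motion_closure T (motions T f g \<U> \<V> a w)"
    and \<U>: "\<And>u t. u \<in> \<U> \<Longrightarrow> t \<in> {0..T} \<Longrightarrow> u t \<in> P" and \<V>: "\<And>v t. v \<in> \<V> \<Longrightarrow> t \<in> {0..T} \<Longrightarrow> v t \<in> Q"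
    and w: "reach a w"
    and x: "solution_on f g a b u v x" "admissible a b u v" "reach a (x a)"
  shows "reach b (y b)"
    and "(norm (y b - x b))\<^sup>2 \<le> (norm (w - x a))\<^sup>2 + drift * (b - a)"
    and "(\<And>u' v' s. u' \<in> \<U> \<Longrightarrow> v' \<in> \<V> \<Longrightarrow> s \<in> {a..b} \<Longrightarrow>
      (w - x a) \<bullet> (f a (x a) (u' s) + g a (x a) (v' s)) \<le> (w - x a) \<bullet> (f a (x a) (u s) + g a (x a) (v s))) \<Longrightarrow>
      (norm (y b - x b))\<^sup>2 \<le> (1 + 4 * L * (b - a)) * (norm (w - x a))\<^sup>2 + (b - a) * \<kappa> (b - a)"
proof -
  have ab: "0 \<le> a" "a \<le> b" "b \<le> T" using x(2) by (auto simp: admissible_def)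
  then have b: "b \<in> {0..T}" by auto
  have motion: "\<exists>u'\<in>\<U>. \<exists>v'\<in>\<V>. solution_on f g a b u' v' z \<and> admissible a b u' v' \<and> z a = w"
    if "z \<in> motions T f g \<U> \<V> a w" for z
    using that ab \<U> \<V> unfolding motions_def admissible_def
    by (fastforce intro: solution_on_subinterval)
  note limit = motion_closure_closed[OF y b]
  have "y b \<in> {z. 1 + norm z \<le> (1 + R\<^sub>0) * exp (2 * K * b)}"
  proof (rule limit)
    show "closed {z::'x. 1 + norm z \<le> (1 + R\<^sub>0) * exp (2 * K * b)}"
      by (intro closed_Collect_le continuous_intros)
    fix z assume "z \<in> motions T f g \<U> \<V> a w"
    from motion[OF this] w ab reach_solution[of a b _ _ z b]
    show "z b \<in> {z. 1 + norm z \<le> (1 + R\<^sub>0) * exp (2 * K * b)}" by (auto simp: reach_def)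
  qed
  then show "reach b (y b)" by (simp add: reach_def)
  have "y b \<in> {z. (norm (z - x b))\<^sup>2 \<le> (norm (w - x a))\<^sup>2 + drift * (b - a)}"
  proof (rule limit)
    show "closed {z. (norm (z - x b))\<^sup>2 \<le> (norm (w - x a))\<^sup>2 + drift * (b - a)}"
      by (intro closed_Collect_le continuous_intros)
    fix z assume "z \<in> motions T f g \<U> \<V> a w"
    from motion[OF this] w distance_growth[OF x, of _ _ z]
    show "z b \<in> {z. (norm (z - x b))\<^sup>2 \<le> (norm (w - x a))\<^sup>2 + drift * (b - a)}" by auto
  qed
  then show "(norm (y b - x b))\<^sup>2 \<le> (norm (w - x a))\<^sup>2 + drift * (b - a)" by simp
  assume extremal: "\<And>u' v' s. u' \<in> \<U> \<Longrightarrow> v' \<in> \<V> \<Longrightarrow> s \<in> {a..b} \<Longrightarrow>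
      (w - x a) \<bullet> (f a (x a) (u' s) + g a (x a) (v' s)) \<le> (w - x a) \<bullet> (f a (x a) (u s) + g a (x a) (v s))"
  have "y b \<in> {z. (norm (z - x b))\<^sup>2 \<le> (1 + 4 * L * (b - a)) * (norm (w - x a))\<^sup>2 + (b - a) * \<kappa> (b - a)}"
  proof (rule limit)
    show "closed {z. (norm (z - x b))\<^sup>2 \<le> (1 + 4 * L * (b - a)) * (norm (w - x a))\<^sup>2 + (b - a) * \<kappa> (b - a)}"
      by (intro closed_Collect_le continuous_intros)
    fix z assume "z \<in> motions T f g \<U> \<V> a w"
    from motion[OF this] obtain u' v' where z: "u' \<in> \<U>" "v' \<in> \<V>" "solution_on f g a b u' v' z"
      "admissible a b u' v'" "z a = w" by blast
    with extremal_shift[OF x z(3,4)] w extremal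
    show "z b \<in> {z. (norm (z - x b))\<^sup>2 \<le> (1 + 4 * L * (b - a)) * (norm (w - x a))\<^sup>2 + (b - a) * \<kappa> (b - a)}" by simp
  qed
  then show "(norm (y b - x b))\<^sup>2 \<le> (1 + 4 * L * (b - a)) * (norm (w - x a))\<^sup>2 + (b - a) * \<kappa> (b - a)" by simp
qed

definition inflate :: "real \<Rightarrow> real \<Rightarrow> real" where
  "inflate h E = (1 + 4 * L * h) * E + h * \<kappa> h"

text \<open>A closed form that dominates the recursion \<open>E \<mapsto> inflate h E\<close>, when it has run for a total time \<open>s\<close>
  with steps of length at most \<open>d\<close> and has picked up an additional error \<open>e\<close>.\<close>

definition error_bound :: "real \<Rightarrow> real \<Rightarrow> real \<Rightarrow> real" where
  "error_bound s d e = exp (4 * L * s) * (s * \<kappa> d + e)"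

lemma inflate_le_error_bound:
  assumes "0 \<le> h" "h \<le> d" "0 \<le> s" "0 \<le> e" "E \<le> error_bound s d e"
  shows "inflate h E \<le> error_bound (s + h) d e"
proof -
  have "(1 + 4 * L * h) * E \<le> (1 + 4 * L * h) * error_bound s d e"
    using assms L by (intro mult_left_mono) auto
  also have "\<dots> \<le> exp (4 * L * h) * error_bound s d e"
    using assms \<kappa>_nonneg[of d] exp_ge_add_one_self[of "4 * L * h"]
    by (intro mult_right_mono) (auto simp: error_bound_def)
  also have "\<dots> = exp (4 * L * (s + h)) * (s * \<kappa> d + e)"
    by (simp add: error_bound_def ring_distribs exp_add)
  finally have "(1 + 4 * L * h) * E \<le> exp (4 * L * (s + h)) * (s * \<kappa> d + e)" .
  moreover have "h * \<kappa> h \<le> 1 * (h * \<kappa> d)"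
    using assms \<kappa>_mono[of h d] by (simp add: mult_left_mono)
  moreover have "1 * (h * \<kappa> d) \<le> exp (4 * L * (s + h)) * (h * \<kappa> d)"
    using assms L \<kappa>_nonneg[of d] by (intro mult_right_mono) auto
  ultimately show ?thesis by (simp add: inflate_def error_bound_def ring_distribs)
qed

lemma error_bound_mono:
  assumes "0 \<le> s" "s \<le> s'" "0 \<le> d" "d \<le> d'" "0 \<le> e" "e \<le> e'"
  shows "error_bound s d e \<le> error_bound s' d' e'"
  unfolding error_bound_def using assms L \<kappa>_nonneg[of d] \<kappa>_mono[of d d']
  by (intro mult_mono add_mono) (auto intro!: mult_left_mono)

lemma error_bound_lim: "((\<lambda>d. error_bound T d (drift * d)) \<longlongrightarrow> 0) (at_right 0)"
  unfolding error_bound_def by (rule tendsto_eq_intros \<kappa>_lim refl | simp)+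

lemma drift_nonneg: "0 \<le> drift"
  using M_nonneg R_pos T by (simp add: drift_def)

end

section \<open>Cooperation and deviation\<close>

context bounded_game
begin

lemma cooperative_step:
  assumes "cooperative c coop" "a \<in> {0..T}" "a \<le> b" "b \<le> T" "reach a w"
    and x: "solution_on f g a b u v x" "admissible a b u v" "reach a (x a)"
  shows "c b (coop a w b) = c a w" "reach b (coop a w b)"
    "(norm (coop a w b - x b))\<^sup>2 \<le> (norm (w - x a))\<^sup>2 + drift * (b - a)"
    "(\<And>p q s. p \<in> P \<Longrightarrow> q \<in> Q \<Longrightarrow> s \<in> {a..b} \<Longrightarrow>
      (w - x a) \<bullet> (f a (x a) p + g a (x a) q) \<le> (w - x a) \<bullet> (f a (x a) (u s) + g a (x a) (v s))) \<Longrightarrow>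
      (norm (coop a w b - x b))\<^sup>2 \<le> inflate (b - a) ((norm (w - x a))\<^sup>2)"
proof -
  have "coop a w \<in> Sol T f g P Q a w" and c: "\<forall>s\<in>{a..T}. c s (coop a w s) = c a w"
    using assms by (auto simp: cooperative_def)
  note step = guide_motion_step[OF this(1)[unfolded Sol_def] _ _ \<open>reach a w\<close> x]
  have c1: "p \<in> open_loop_controls T P \<Longrightarrow> t \<in> {0..T} \<Longrightarrow> p t \<in> P"
    and c2: "q \<in> open_loop_controls T Q \<Longrightarrow> t \<in> {0..T} \<Longrightarrow> q t \<in> Q" for p q t
    by (auto simp: open_loop_controls_def)
  show "c b (coop a w b) = c a w" using c assms by auto
  show "reach b (coop a w b)" using c1 c2 by (rule step(1))
  show "(norm (coop a w b - x b))\<^sup>2 \<le> (norm (w - x a))\<^sup>2 + drift * (b - a)"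
    using c1 c2 by (rule step(2))
  assume extremal: "\<And>p q s. p \<in> P \<Longrightarrow> q \<in> Q \<Longrightarrow> s \<in> {a..b} \<Longrightarrow>
      (w - x a) \<bullet> (f a (x a) p + g a (x a) q) \<le> (w - x a) \<bullet> (f a (x a) (u s) + g a (x a) (v s))"
  show "(norm (coop a w b - x b))\<^sup>2 \<le> inflate (b - a) ((norm (w - x a))\<^sup>2)"
    unfolding inflate_def using assms c1 c2 by (intro step(3) extremal) auto
qed

lemma punishing_step:
  assumes pun: "punishing c pun" "a \<in> {0..T}" "a \<le> b" "b \<le> T" "reach a w"
    and x: "solution_on f g a b (\<lambda>_. u) v x" "admissible a b (\<lambda>_. u) v" "reach a (x a)"
    and u: "\<And>p. p \<in> P \<Longrightarrow> (w - x a) \<bullet> f a (x a) p \<le> (w - x a) \<bullet> f a (x a) u"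
  shows "c b (pun a w (x a) b) \<le> c a w" "reach b (pun a w (x a) b)"
    "(norm (pun a w (x a) b - x b))\<^sup>2 \<le> inflate (b - a) ((norm (w - x a))\<^sup>2)"
proof -
  obtain q where q: "q \<in> Q" "\<And>v'. v' \<in> Q \<Longrightarrow> (w - x a) \<bullet> g a (x a) q \<le> (w - x a) \<bullet> g a (x a) v'"
    and y: "pun a w (x a) \<in> Sol1 T f g P a w q" and c: "\<forall>s\<in>{a..T}. c s (pun a w (x a) s) \<le> c a w"
    using pun(1,2) unfolding punishing_def by metis
  note step = guide_motion_step[OF y[unfolded Sol1_def] _ _ \<open>reach a w\<close> x]
  have c1: "p \<in> open_loop_controls T P \<Longrightarrow> t \<in> {0..T} \<Longrightarrow> p t \<in> P"
    and c2: "p' \<in> {\<lambda>_. q} \<Longrightarrow> t \<in> {0..T} \<Longrightarrow> p' t \<in> Q" for p p' t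
    using q by (auto simp: open_loop_controls_def)
  show "c b (pun a w (x a) b) \<le> c a w" using c pun by auto
  show "reach b (pun a w (x a) b)" using c1 c2 by (rule step(1))
  show "(norm (pun a w (x a) b - x b))\<^sup>2 \<le> inflate (b - a) ((norm (w - x a))\<^sup>2)"
    unfolding inflate_def
  proof (rule step(3))
    show "p t \<in> P" if "p \<in> open_loop_controls T P" "t \<in> {0..T}" for p t using that by (rule c1)
    show "p t \<in> Q" if "p \<in> {\<lambda>_. q}" "t \<in> {0..T}" for p t using that by (rule c2)
    fix p and p' :: "real \<Rightarrow> 'q" and s
    assume "p \<in> open_loop_controls T P" "p' \<in> {\<lambda>_. q}" "s \<in> {a..b}"
    moreover from this have "p s \<in> P" using c1 pun by auto
    ultimately show "(w - x a) \<bullet> (f a (x a) (p s) + g a (x a) (p' s)) \<le> (w - x a) \<bullet> (f a (x a) u + g a (x a) (v s))"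
      using x(2) u[of "p s"] q(2)[of "v s"] by (auto simp: admissible_def inner_add_right intro!: add_mono)
  qed
qed

text \<open>The invariant along the partition has two bounds: the tolerance satisfies the recursion started at
  \<open>0\<close>, and the squared distance the one started at \<open>drift * \<delta>\<close>. The latter absorbs the one step during
  which a deviation is not noticed: such a step begins with a distance within the tolerance, so no
  error accumulates even if cooperative and punishing steps alternate.\<close>

lemma deviation_outcome:
  assumes coop: "cooperative c coop" and pun: "punishing c pun"
    and U: "U = shift_strategy P f inflate coop pun"
    and t\<^sub>0: "t\<^sub>0 \<in> {0..T}" "reach t\<^sub>0 x\<^sub>0" and \<delta>: "0 \<le> \<delta>" and z: "z \<in> outcomes1 T f g Q U t\<^sub>0 x\<^sub>0 \<delta>"
  obtains w where "c T w \<le> c t\<^sub>0 x\<^sub>0" "norm w \<le> R" "norm z \<le> R" "(norm (w - z))\<^sup>2 \<le> error_bound T \<delta> (drift * \<delta>)"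
proof -
  obtain x r \<tau> v where x: "z = x T" "partition_of t\<^sub>0 T r \<tau>" "mesh r \<tau> \<le> \<delta>" "v \<in> open_loop_controls T Q"
    "x (\<tau> 0) = x\<^sub>0" "\<And>k. k < r \<Longrightarrow> solution_on f g (\<tau> k) (\<tau> (Suc k)) (\<lambda>_. feedback U \<tau> x k) v x"
    using z by (auto simp: outcomes1_def motion1_def stepwise_motion_def)
  define w :: "nat \<Rightarrow> 'x" where "w k = position (guide U \<tau> x k)" for k
  define \<theta> where "\<theta> k = tolerance (guide U \<tau> x k)" for k
  have \<tau>: "\<tau> 0 = t\<^sub>0" "\<tau> r = T" "\<And>k. k \<le> r \<Longrightarrow> \<tau> k \<in> {t\<^sub>0..T}" "\<And>k. k < r \<Longrightarrow> \<tau> k \<le> \<tau> (Suc k)"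
    "\<And>k. k < r \<Longrightarrow> \<tau> (Suc k) - \<tau> k \<le> \<delta>"
    using x(2,3) partition_of_bounds[OF x(2)] step_le_mesh[of _ r \<tau>]
    by (auto simp: partition_of_def intro: less_imp_le order_trans)
  have "k \<le> r \<Longrightarrow> reach (\<tau> k) (w k) \<and> reach (\<tau> k) (x (\<tau> k)) \<and> c (\<tau> k) (w k) \<le> c t\<^sub>0 x\<^sub>0 \<and>
      \<theta> k \<le> error_bound (\<tau> k - t\<^sub>0) \<delta> 0 \<and> (norm (w k - x (\<tau> k)))\<^sup>2 \<le> error_bound (\<tau> k - t\<^sub>0) \<delta> (drift * \<delta>)" for k
  proof (induction k)
    case 0
    show ?case using t\<^sub>0 x(5) \<tau> drift_nonneg \<delta> by (simp add: w_def \<theta>_def U shift_strategy_def error_bound_def)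
  next
    case (Suc k)
    define a where "a = \<tau> k"
    define b where "b = \<tau> (Suc k)"
    define E where "E = (norm (w k - x a))\<^sup>2"
    have k: "k < r" "k \<le> r" using Suc.prems by auto
    have IH: "reach a (w k)" "reach a (x a)" "c a (w k) \<le> c t\<^sub>0 x\<^sub>0" "\<theta> k \<le> error_bound (a - t\<^sub>0) \<delta> 0"
      "E \<le> error_bound (a - t\<^sub>0) \<delta> (drift * \<delta>)"
      using Suc.IH k by (auto simp: a_def E_def)
    have ab: "a \<in> {0..T}" "t\<^sub>0 \<le> a" "a \<le> b" "b \<le> T" "0 \<le> b - a" "b - a \<le> \<delta>"
      using \<tau>(3)[of k] \<tau>(3)[of "Suc k"] \<tau>(4,5)[OF k(1)] k Suc.prems t\<^sub>0 by (auto simp: a_def b_def)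
    have u: "feedback U \<tau> x k \<in> P"
      "\<And>p. p \<in> P \<Longrightarrow> (w k - x a) \<bullet> f a (x a) p \<le> (w k - x a) \<bullet> f a (x a) (feedback U \<tau> x k)"
      using control_shift_strategy[OF ab(1), of _ inflate coop pun] ab
      by (auto simp: U feedback_def w_def a_def)
    have sol: "solution_on f g a b (\<lambda>_. feedback U \<tau> x k) v x"
      using x(6)[OF k(1)] by (simp add: a_def b_def)
    have adm: "admissible a b (\<lambda>_. feedback U \<tau> x k) v"
      using u(1) x(4) ab by (auto simp: admissible_def open_loop_controls_def)
    have "guide U \<tau> x (Suc k) = encode (if E \<le> \<theta> k then coop a (w k) b else pun a (w k) (x a) b)
        (inflate (b - a) (\<theta> k))"
      unfolding E_def a_def b_def by (rule guide_shift_strategy_Suc[OF U w_def \<theta>_def])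
    then have w': "w (Suc k) = (if E \<le> \<theta> k then coop a (w k) b else pun a (w k) (x a) b)"
      and \<theta>': "\<theta> (Suc k) = inflate (b - a) (\<theta> k)"
      by (auto simp: w_def \<theta>_def)
    note coop_step = cooperative_step[OF coop ab(1,3,4) IH(1) sol adm IH(2)]
    note pun_step = punishing_step[OF pun ab(1,3,4) IH(1) sol adm IH(2) u(2)]
    have eq: "a - t\<^sub>0 + (b - a) = b - t\<^sub>0" by simp
    have "reach b (x b)" using reach_solution[OF sol adm IH(2), of b] ab by auto
    moreover have "reach b (w (Suc k))" "c b (w (Suc k)) \<le> c t\<^sub>0 x\<^sub>0"
      using coop_step(1,2) pun_step(1,2) IH(3) by (auto simp: w')
    moreover have "\<theta> (Suc k) \<le> error_bound (b - t\<^sub>0) \<delta> 0"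
      using inflate_le_error_bound[of "b - a" \<delta> "a - t\<^sub>0" 0 "\<theta> k"] IH(4) ab unfolding \<theta>' eq by simp
    moreover have "(norm (w (Suc k) - x b))\<^sup>2 \<le> error_bound (b - t\<^sub>0) \<delta> (drift * \<delta>)"
    proof (cases "E \<le> \<theta> k")
      case True
      \<comment> \<open>The step may hide a deviation, so the old distance is replaced by the tolerance, whose bound
        lacks the summand \<open>drift * \<delta>\<close>.\<close>
      then have "(norm (w (Suc k) - x b))\<^sup>2 \<le> error_bound (a - t\<^sub>0) \<delta> 0 + drift * (b - a)"
        using coop_step(3) IH(4) by (simp add: w' E_def)
      also have "\<dots> \<le> error_bound (a - t\<^sub>0) \<delta> 0 + exp (4 * L * (a - t\<^sub>0)) * (drift * \<delta>)"
      proof (intro add_left_mono)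
        have "drift * (b - a) \<le> 1 * (drift * \<delta>)" using ab drift_nonneg by (simp add: mult_left_mono)
        also have "\<dots> \<le> exp (4 * L * (a - t\<^sub>0)) * (drift * \<delta>)"
          using ab drift_nonneg L \<delta> by (intro mult_right_mono) auto
        finally show "drift * (b - a) \<le> exp (4 * L * (a - t\<^sub>0)) * (drift * \<delta>)" .
      qed
      also have "\<dots> = error_bound (a - t\<^sub>0) \<delta> (drift * \<delta>)" by (simp add: error_bound_def ring_distribs)
      also have "\<dots> \<le> error_bound (b - t\<^sub>0) \<delta> (drift * \<delta>)"
        using ab \<delta> drift_nonneg by (intro error_bound_mono) auto
      finally show ?thesis .
    next
      case False
      then show ?thesis
        using pun_step(3) inflate_le_error_bound[of "b - a" \<delta> "a - t\<^sub>0" "drift * \<delta>" E] IH(5) ab drift_nonneg \<delta>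
        unfolding eq by (simp add: w' E_def)
    qed
    ultimately show ?case by (simp add: b_def)
  qed
  from this[of r] have *: "reach T (w r)" "reach T (x T)" "c T (w r) \<le> c t\<^sub>0 x\<^sub>0"
    "(norm (w r - x T))\<^sup>2 \<le> error_bound (T - t\<^sub>0) \<delta> (drift * \<delta>)" by (auto simp: \<tau>)
  have "error_bound (T - t\<^sub>0) \<delta> (drift * \<delta>) \<le> error_bound T \<delta> (drift * \<delta>)"
    using t\<^sub>0 \<delta> drift_nonneg by (intro error_bound_mono) auto
  with * show thesis
    using reach_bound[OF *(1)] reach_bound[OF *(2)] by (intro that[of "w r"]) (auto simp: x(1))
qed

text \<open>By induction the state never leaves the tolerance, so both players always make the same
  cooperative step and their guides, tolerances included, are equal. This is why the tolerance has
  to follow exactly the recursion of \<open>extremal_shift\<close>.\<close>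

lemma cooperation_outcome:
  assumes coop: "cooperative c coop"
    and U: "U = shift_strategy P f inflate coop pun\<^sub>1" and V: "V = shift_strategy Q g inflate coop pun\<^sub>2"
    and t\<^sub>0: "t\<^sub>0 \<in> {0..T}" "reach t\<^sub>0 x\<^sub>0" and \<delta>: "0 \<le> \<delta>" and z: "z \<in> outcomes_c T f g U V t\<^sub>0 x\<^sub>0 \<delta>"
  obtains w where "c T w = c t\<^sub>0 x\<^sub>0" "norm w \<le> R" "norm z \<le> R"
    "(norm (w - z))\<^sup>2 \<le> error_bound T \<delta> (drift * \<delta>)"
proof -
  interpret S: game T Q P g f L K by (rule swap)
  obtain x r \<tau> where x: "z = x T" "partition_of t\<^sub>0 T r \<tau>" "mesh r \<tau> \<le> \<delta>" "x (\<tau> 0) = x\<^sub>0"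
    "\<And>k. k < r \<Longrightarrow> solution_on f g (\<tau> k) (\<tau> (Suc k)) (\<lambda>_. feedback U \<tau> x k) (\<lambda>_. feedback V \<tau> x k) x"
    using z by (auto simp: outcomes_c_def motion_c_def stepwise_motion_def)
  define w :: "nat \<Rightarrow> 'x" where "w k = position (guide U \<tau> x k)" for k
  define \<theta> where "\<theta> k = tolerance (guide U \<tau> x k)" for k
  have \<tau>: "\<tau> 0 = t\<^sub>0" "\<tau> r = T" "\<And>k. k \<le> r \<Longrightarrow> \<tau> k \<in> {t\<^sub>0..T}" "\<And>k. k < r \<Longrightarrow> \<tau> k \<le> \<tau> (Suc k)"
    "\<And>k. k < r \<Longrightarrow> \<tau> (Suc k) - \<tau> k \<le> \<delta>"
    using x(2,3) partition_of_bounds[OF x(2)] step_le_mesh[of _ r \<tau>]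
    by (auto simp: partition_of_def intro: less_imp_le order_trans)
  have "k \<le> r \<Longrightarrow> guide V \<tau> x k = guide U \<tau> x k \<and> reach (\<tau> k) (w k) \<and> reach (\<tau> k) (x (\<tau> k)) \<and>
      c (\<tau> k) (w k) = c t\<^sub>0 x\<^sub>0 \<and> \<theta> k \<le> error_bound (\<tau> k - t\<^sub>0) \<delta> 0 \<and> (norm (w k - x (\<tau> k)))\<^sup>2 \<le> \<theta> k" for k
  proof (induction k)
    case 0
    show ?case using t\<^sub>0 x(4) \<tau> by (simp add: w_def \<theta>_def U V shift_strategy_def error_bound_def)
  next
    case (Suc k)
    define a where "a = \<tau> k"
    define b where "b = \<tau> (Suc k)"
    have k: "k < r" "k \<le> r" using Suc.prems by auto
    have IH: "guide V \<tau> x k = guide U \<tau> x k" "reach a (w k)" "reach a (x a)" "c a (w k) = c t\<^sub>0 x\<^sub>0"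
      "\<theta> k \<le> error_bound (a - t\<^sub>0) \<delta> 0" "(norm (w k - x a))\<^sup>2 \<le> \<theta> k"
      using Suc.IH k by (auto simp: a_def)
    have ab: "a \<in> {0..T}" "t\<^sub>0 \<le> a" "a \<le> b" "b \<le> T" "0 \<le> b - a" "b - a \<le> \<delta>"
      using \<tau>(3)[of k] \<tau>(3)[of "Suc k"] \<tau>(4,5)[OF k(1)] k Suc.prems t\<^sub>0 by (auto simp: a_def b_def)
    have u: "feedback U \<tau> x k \<in> P"
      "\<And>p. p \<in> P \<Longrightarrow> (w k - x a) \<bullet> f a (x a) p \<le> (w k - x a) \<bullet> f a (x a) (feedback U \<tau> x k)"
      using control_shift_strategy[OF ab(1), of _ inflate coop pun\<^sub>1] ab
      by (auto simp: U feedback_def w_def a_def)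
    have v: "feedback V \<tau> x k \<in> Q"
      "\<And>q. q \<in> Q \<Longrightarrow> (w k - x a) \<bullet> g a (x a) q \<le> (w k - x a) \<bullet> g a (x a) (feedback V \<tau> x k)"
      using S.control_shift_strategy[OF ab(1), of _ inflate coop pun\<^sub>2] ab
      unfolding w_def IH(1)[symmetric] by (auto simp: V feedback_def a_def)
    have sol: "solution_on f g a b (\<lambda>_. feedback U \<tau> x k) (\<lambda>_. feedback V \<tau> x k) x"
      using x(5)[OF k(1)] by (simp add: a_def b_def)
    have adm: "admissible a b (\<lambda>_. feedback U \<tau> x k) (\<lambda>_. feedback V \<tau> x k)"
      using u(1) v(1) ab by (auto simp: admissible_def)
    note step = cooperative_step[OF _ ab(1,3,4) IH(2) sol adm IH(3)]
    have g: "guide U \<tau> x (Suc k) = encode (coop a (w k) b) (inflate (b - a) (\<theta> k))"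
      using guide_shift_strategy_Suc[OF U w_def \<theta>_def, of k] IH(6) by (simp add: a_def b_def)
    moreover have "guide V \<tau> x (Suc k) = encode (coop a (w k) b) (inflate (b - a) (\<theta> k))"
      using guide_shift_strategy_Suc[OF V, of "w k" \<tau> x k "\<theta> k"] IH(1,6) by (simp add: a_def b_def w_def \<theta>_def)
    ultimately have "guide V \<tau> x (Suc k) = guide U \<tau> x (Suc k)" by simp
    moreover have w': "w (Suc k) = coop a (w k) b" and \<theta>': "\<theta> (Suc k) = inflate (b - a) (\<theta> k)"
      using g by (auto simp: w_def \<theta>_def)
    moreover have "reach b (x b)" using reach_solution[OF sol adm IH(3), of b] ab by auto
    moreover have "reach b (coop a (w k) b)" "c b (coop a (w k) b) = c t\<^sub>0 x\<^sub>0"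
      using step(1,2)[OF coop] IH(4) by auto
    moreover have "inflate (b - a) (\<theta> k) \<le> error_bound (b - t\<^sub>0) \<delta> 0"
      using inflate_le_error_bound[of "b - a" \<delta> "a - t\<^sub>0" 0 "\<theta> k"] IH(5) ab by simp
    moreover have "(norm (coop a (w k) b - x b))\<^sup>2 \<le> inflate (b - a) (\<theta> k)"
    proof -
      have "(norm (coop a (w k) b - x b))\<^sup>2 \<le> inflate (b - a) ((norm (w k - x a))\<^sup>2)"
        using u(2) v(2) by (intro step(4)[OF coop]) (auto simp: inner_add_right intro!: add_mono)
      also have "\<dots> \<le> inflate (b - a) (\<theta> k)"
        using IH(6) ab L by (auto simp: inflate_def intro!: mult_left_mono)
      finally show ?thesis .
    qed
    ultimately show ?case by (simp add: b_def)
  qed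
  from this[of r] have *: "reach T (w r)" "reach T (x T)" "c T (w r) = c t\<^sub>0 x\<^sub>0"
    "(norm (w r - x T))\<^sup>2 \<le> error_bound (T - t\<^sub>0) \<delta> 0" by (auto simp: \<tau>)
  have "error_bound (T - t\<^sub>0) \<delta> 0 \<le> error_bound T \<delta> (drift * \<delta>)"
    using t\<^sub>0 \<delta> drift_nonneg by (intro error_bound_mono) auto
  with * show thesis
    using reach_bound[OF *(1)] reach_bound[OF *(2)] by (intro that[of "w r"]) (auto simp: x(1))
qed

end

section \<open>Existence of motions under guide strategies\<close>

lemma guide_cong: "(\<And>j. j \<le> k \<Longrightarrow> x (\<tau> j) = y (\<tau> j)) \<Longrightarrow> guide U \<tau> x k = guide U \<tau> y k"
  by (induction k) auto

lemma feedback_cong: "(\<And>j. j \<le> k \<Longrightarrow> x (\<tau> j) = y (\<tau> j)) \<Longrightarrow> feedback U \<tau> x k = feedback U \<tau> y k"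
  unfolding feedback_def using guide_cong[of k x \<tau> y U] by simp

lemma feedback_in:
  assumes "is_guide_strategy T P U" and \<tau>: "\<And>j. j \<le> k \<Longrightarrow> \<tau> j \<in> {0..T}"
  shows "feedback U \<tau> x k \<in> P"
proof -
  obtain m where m: "\<forall>t\<in>{0..T}. \<forall>x. \<forall>w\<in>topspace (Euclidean_space m). control U t x w \<in> P"
    "\<forall>t\<in>{0..T}. \<forall>s\<in>{0..T}. \<forall>x. \<forall>w\<in>topspace (Euclidean_space m). guide_step U t s x w \<in> topspace (Euclidean_space m)"
    "\<forall>t\<in>{0..T}. \<forall>x. guide_init U t x \<in> topspace (Euclidean_space m)"
    using assms(1) unfolding is_guide_strategy_def by blast
  have "guide U \<tau> x j \<in> topspace (Euclidean_space m)" if "j \<le> k" for j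
    using that
  proof (induction j)
    case 0
    show ?case using m(3) \<tau>[of 0] by simp
  next
    case (Suc j)
    then show ?case using m(2) \<tau>[of j] \<tau>[of "Suc j"] by simp
  qed
  then show ?thesis using m(1) \<tau>[of k] by (simp add: feedback_def)
qed

context game
begin

text \<open>The controls on the interval number \<open>k\<close> depend on the motion only through its values at the first
  \<open>k + 1\<close> partition points, so a motion can be continued interval by interval.\<close>

lemma motion_c_exists:
  assumes U: "is_guide_strategy T P U" and V: "is_guide_strategy T Q V"
    and part: "partition_of t\<^sub>0 T r \<tau>" and t\<^sub>0: "0 \<le> t\<^sub>0"
    and short: "\<And>k. k < r \<Longrightarrow> 2 * L * (\<tau> (Suc k) - \<tau> k) < 1"
  obtains x where "motion_c f g x\<^sub>0 U V r \<tau> x"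
proof -
  have \<tau>: "\<tau> j \<in> {0..T}" if "j \<le> r" for j
    using partition_of_bounds[OF part that] t\<^sub>0 by auto
  have "k \<le> r \<Longrightarrow> \<exists>x. x (\<tau> 0) = x\<^sub>0 \<and> (\<forall>j<k. solution_on f g (\<tau> j) (\<tau> (Suc j))
      (\<lambda>_. feedback U \<tau> x j) (\<lambda>_. feedback V \<tau> x j) x)" for k
  proof (induction k)
    case (Suc k)
    then obtain x where x: "x (\<tau> 0) = x\<^sub>0" "\<And>j. j < k \<Longrightarrow> solution_on f g (\<tau> j) (\<tau> (Suc j))
      (\<lambda>_. feedback U \<tau> x j) (\<lambda>_. feedback V \<tau> x j) x" by auto
    have in_P: "feedback U \<tau> x k \<in> P" "feedback V \<tau> x k \<in> Q"
      using Suc.prems \<tau> by (auto intro!: feedback_in[OF U] feedback_in[OF V])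
    have k: "0 \<le> \<tau> k" "\<tau> k \<le> \<tau> (Suc k)" "\<tau> (Suc k) \<le> T" "2 * L * (\<tau> (Suc k) - \<tau> k) < 1"
      using \<tau>[of k] \<tau>[of "Suc k"] partition_of_le[OF part, of k "Suc k"] Suc.prems short[of k] by auto
    obtain y where y: "y (\<tau> k) = x (\<tau> k)"
      "solution_on f g (\<tau> k) (\<tau> (Suc k)) (\<lambda>_. feedback U \<tau> x k) (\<lambda>_. feedback V \<tau> x k) y"
      using constant_control_solution_exists[OF k(1-3) in_P k(4)] by blast
    define z where "z t = (if t \<le> \<tau> k then x t else y t)" for t
    have le: "\<tau> j \<le> \<tau> k" if "j \<le> k" for j
      using partition_of_le[OF part that] Suc.prems by simp
    have fb: "feedback W \<tau> z j = feedback W \<tau> x j" if "j \<le> k" for W :: "('x, 'c) guide_strategy" and j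
      using that le by (intro feedback_cong) (auto simp: z_def)
    have "solution_on f g (\<tau> j) (\<tau> (Suc j)) (\<lambda>_. feedback U \<tau> z j) (\<lambda>_. feedback V \<tau> z j) z"
      if "j < Suc k" for j
    proof (cases "j = k")
      case True
      have "solution_on f g (\<tau> k) (\<tau> (Suc k)) (\<lambda>_. feedback U \<tau> x k) (\<lambda>_. feedback V \<tau> x k) z"
        using y(2) by (rule solution_on_cong[THEN iffD1, rotated -1]) (use y(1) in \<open>auto simp: z_def\<close>)
      then show ?thesis using True by (simp add: fb)
    next
      case False
      then have "j < k" using that by simp
      have "solution_on f g (\<tau> j) (\<tau> (Suc j)) (\<lambda>_. feedback U \<tau> x j) (\<lambda>_. feedback V \<tau> x j) z"
        using x(2)[OF \<open>j < k\<close>]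
        by (rule solution_on_cong[THEN iffD1, rotated -1]) (use le[of "Suc j"] \<open>j < k\<close> in \<open>auto simp: z_def\<close>)
      then show ?thesis using \<open>j < k\<close> by (simp add: fb)
    qed
    moreover have "z (\<tau> 0) = x\<^sub>0" using x(1) le[of 0] by (simp add: z_def)
    ultimately show ?case by blast
  qed (auto intro: exI[of _ "\<lambda>_. x\<^sub>0"])
  from this[of r] that show thesis
    by (auto simp: motion_c_def stepwise_motion_def)
qed

text \<open>A uniform partition into pieces on which the Picard operator contracts.\<close>

lemma outcomes_c_nonempty:
  assumes U: "is_guide_strategy T P U" and V: "is_guide_strategy T Q V"
    and t\<^sub>0: "t\<^sub>0 \<in> {0..T}" and "0 < \<delta>"
  shows "outcomes_c T f g U V t\<^sub>0 x\<^sub>0 \<delta> \<noteq> {}"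
proof -
  \<comment> \<open>The summand \<open>1\<close> keeps the quotient meaningful for \<open>L = 0\<close> and the contraction strict.\<close>
  define e where "e = min \<delta> (1 / (2 * L + 1))"
  have e: "0 < e" "e \<le> \<delta>" using \<open>0 < \<delta>\<close> L by (auto simp: e_def)
  have "2 * L * e \<le> 2 * L * (1 / (2 * L + 1))" using L by (intro mult_left_mono) (auto simp: e_def)
  also have "\<dots> < 1" using L by (simp add: field_simps)
  finally have short: "2 * L * e < 1" .
  obtain r \<tau> where part: "partition_of t\<^sub>0 T r \<tau>" and step: "\<And>k. k < r \<Longrightarrow> \<tau> (Suc k) - \<tau> k \<le> e"
  proof (cases "t\<^sub>0 = T")
    case True
    then show thesis by (intro that[of 0 "\<lambda>_. T"]) (auto simp: partition_of_def)
  next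
    case False
    then have pos: "0 < T - t\<^sub>0" using t\<^sub>0 by auto
    obtain N where N: "(T - t\<^sub>0) / e < real N" using reals_Archimedean2 by blast
    have "0 < N" using N pos e by (metis divide_pos_pos less_trans of_nat_0_less_iff)
    have diff: "t\<^sub>0 + real (Suc k) * ((T - t\<^sub>0) / N) - (t\<^sub>0 + real k * ((T - t\<^sub>0) / N)) = (T - t\<^sub>0) / N" for k
      by (simp only: of_nat_Suc ring_distribs)
    show thesis
    proof (rule that[of N "\<lambda>k. t\<^sub>0 + real k * ((T - t\<^sub>0) / N)"])
      show "partition_of t\<^sub>0 T N (\<lambda>k. t\<^sub>0 + real k * ((T - t\<^sub>0) / N))"
        using \<open>0 < N\<close> pos by (auto simp: partition_of_def intro!: divide_strict_right_mono mult_strict_right_mono)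
      show "t\<^sub>0 + real (Suc k) * ((T - t\<^sub>0) / N) - (t\<^sub>0 + real k * ((T - t\<^sub>0) / N)) \<le> e" for k
        unfolding diff using N e \<open>0 < N\<close> by (simp add: field_simps)
    qed
  qed
  have "mesh r \<tau> \<le> \<delta>"
    unfolding mesh_def using step e \<open>0 < \<delta>\<close> by (intro Max.boundedI) (auto intro: order_trans)
  moreover have "2 * L * (\<tau> (Suc k) - \<tau> k) < 1" if "k < r" for k
    using mult_left_mono[OF step[OF that], of "2 * L"] L short by simp
  then obtain x where "motion_c f g x\<^sub>0 U V r \<tau> x"
    using motion_c_exists[OF U V part] t\<^sub>0 by auto
  ultimately show ?thesis using part by (auto simp: outcomes_c_def)
qed

end

section \<open>Limits of values over shrinking meshes\<close>

lemma mono_tendsto_at_right_0: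
  fixes F :: "real \<Rightarrow> ereal"
  assumes "\<And>d d'. 0 < d \<Longrightarrow> d \<le> d' \<Longrightarrow> F d \<le> F d'"
  shows "(F \<longlongrightarrow> (INF d\<in>{0<..}. F d)) (at_right 0)"
proof (rule order_tendstoI)
  fix a assume "a < (INF d\<in>{0<..}. F d)"
  then have "a < F d" if "0 < d" for d
    using that by (meson INF_lower greaterThan_iff less_le_trans)
  then show "\<forall>\<^sub>F d in at_right 0. a < F d"
    by (auto simp: eventually_at_right_field intro: exI[of _ 1])
next
  fix a assume "(INF d\<in>{0<..}. F d) < a"
  then obtain d where "0 < d" "F d < a" by (auto simp: INF_less_iff)
  then have "F y < a" if "0 < y" "y < d" for y
    using assms[of y d] that by (meson le_less_trans less_imp_le)
  with \<open>0 < d\<close> show "\<forall>\<^sub>F d in at_right 0. F d < a"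
    by (auto simp: eventually_at_right_field)
qed

lemma Lim_SUP_le:
  fixes \<phi> :: "'a \<Rightarrow> real" and A :: "real \<Rightarrow> 'a set"
  assumes mono: "\<And>d d'. d \<le> d' \<Longrightarrow> A d \<subseteq> A d'"
    and le: "\<And>e. 0 < e \<Longrightarrow> \<forall>\<^sub>F d in at_right 0. \<forall>y\<in>A d. \<phi> y \<le> c + e"
  shows "Lim (at_right 0) (\<lambda>d. SUP y\<in>A d. ereal (\<phi> y)) \<le> ereal c"
proof -
  let ?F = "\<lambda>d. SUP y\<in>A d. ereal (\<phi> y)"
  have lim: "(?F \<longlongrightarrow> (INF d\<in>{0<..}. ?F d)) (at_right 0)"
    by (rule mono_tendsto_at_right_0[of ?F]) (intro SUP_subset_mono mono, auto)
  have "(INF d\<in>{0<..}. ?F d) \<le> ereal c"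
  proof (rule ereal_le_epsilon2)
    fix e :: real assume "0 < e"
    have "\<forall>\<^sub>F d in at_right 0. ?F d \<le> ereal (c + e)"
      using le[OF \<open>0 < e\<close>] by eventually_elim (auto intro!: SUP_least)
    from tendsto_upperbound[OF lim this] show "(INF d\<in>{0<..}. ?F d) \<le> ereal c + ereal e" by simp
  qed
  then show ?thesis using tendsto_Lim[OF _ lim] by simp
qed

lemma Lim_INF_eq:
  fixes \<phi> :: "'a \<Rightarrow> real" and A :: "real \<Rightarrow> 'a set"
  assumes ne: "\<And>d. 0 < d \<Longrightarrow> A d \<noteq> {}"
    and le: "\<And>e. 0 < e \<Longrightarrow> \<forall>\<^sub>F d in at_right 0. \<forall>y\<in>A d. \<bar>\<phi> y - c\<bar> \<le> e"
  shows "Lim (at_right 0) (\<lambda>d. INF y\<in>A d. ereal (\<phi> y)) = ereal c"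
proof -
  let ?F = "\<lambda>d. INF y\<in>A d. ereal (\<phi> y)"
  have pos: "\<forall>\<^sub>F d in at_right (0::real). 0 < d" by (simp add: eventually_at_right_less)
  have "(?F \<longlongrightarrow> ereal c) (at_right 0)"
  proof (rule order_tendstoI)
    fix a assume "a < ereal c"
    then obtain s where s: "a < ereal s" "s < c" using ereal_dense2 less_ereal.simps(1) by blast
    have pos_s: "0 < c - s" using s(2) by simp
    show "\<forall>\<^sub>F d in at_right 0. a < ?F d"
      using le[OF pos_s]
    proof eventually_elim
      case (elim d)
      have "ereal s \<le> ereal (\<phi> y)" if "y \<in> A d" for y using elim that by (force simp: abs_le_iff)
      then have "ereal s \<le> ?F d" by (rule INF_greatest)
      with s(1) show "a < ?F d" by (rule less_le_trans)
    qed
  next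
    fix a assume "ereal c < a"
    then obtain s where s: "ereal s < a" "c < s" using ereal_dense2 less_ereal.simps(1) by blast
    have pos_s: "0 < s - c" using s(2) by simp
    show "\<forall>\<^sub>F d in at_right 0. ?F d < a"
      using le[OF pos_s] pos
    proof eventually_elim
      case (elim d)
      then obtain y where y: "y \<in> A d" using ne by blast
      have "?F d \<le> ereal (\<phi> y)" using y by (rule INF_lower)
      also have "\<dots> \<le> ereal s" using elim y by (force simp: abs_le_iff)
      also have "\<dots> < a" by (rule s(1))
      finally show "?F d < a" .
    qed
  qed
  then show ?thesis by (intro tendsto_Lim) auto
qed

section \<open>Exchanging the players\<close>

lemma motions_swap: "motions T g f \<V> \<U> = motions T f g \<U> \<V>"
proof -
  have "(\<exists>v\<in>\<V>. \<exists>u\<in>\<U>. solution_on g f 0 T v u x) \<longleftrightarrow> (\<exists>u\<in>\<U>. \<exists>v\<in>\<V>. solution_on f g 0 T u v x)" for x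
    unfolding solution_on_swap[of g f] by blast
  then show ?thesis by (intro ext) (simp add: motions_def)
qed

lemma Sol_swap: "Sol T g f Q P = Sol T f g P Q"
  by (intro ext) (simp add: Sol_def motions_swap[of T g f])

lemma Sol1_swap: "Sol1 T g f Q = Sol2 T f g Q"
  by (intro ext) (simp add: Sol1_def Sol2_def motions_swap[of T g f])

lemma outcomes1_swap: "outcomes1 T g f P V = outcomes2 T f g P V"
  by (intro ext) (simp add: outcomes1_def outcomes2_def motion1_def motion2_def stepwise_motion_def
      solution_on_swap[of g f])

section \<open>Values of the strategies\<close>

context bounded_game
begin

text \<open>Uniform continuity of the payoff on the ball of radius \<open>R\<close>, in the form in which it is combined with the
  two outcome lemmas.\<close>

lemma eventually_payoff_close:
  fixes \<sigma> :: "'x \<Rightarrow> real"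
  assumes "continuous_on UNIV \<sigma>" "0 < e"
  shows "\<forall>\<^sub>F d in at_right 0. 0 < d \<and> (\<forall>w z. norm w \<le> R \<longrightarrow> norm z \<le> R \<longrightarrow>
    (norm (w - z))\<^sup>2 \<le> error_bound T d (drift * d) \<longrightarrow> \<bar>\<sigma> w - \<sigma> z\<bar> \<le> e)"
proof -
  have "uniformly_continuous_on (cball 0 R) \<sigma>"
    by (rule compact_uniformly_continuous[OF continuous_on_subset[OF assms(1) subset_UNIV] compact_cball])
  then obtain \<eta> where \<eta>: "0 < \<eta>"
    "\<And>z w. z \<in> cball 0 R \<Longrightarrow> w \<in> cball 0 R \<Longrightarrow> dist w z < \<eta> \<Longrightarrow> dist (\<sigma> w) (\<sigma> z) < e"
    using \<open>0 < e\<close> by (rule uniformly_continuous_onE) (rule that)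
  have "\<forall>\<^sub>F d in at_right 0. error_bound T d (drift * d) < \<eta>\<^sup>2"
    using order_tendstoD(2)[OF error_bound_lim] \<eta>(1) by simp
  moreover have "\<forall>\<^sub>F d in at_right (0::real). 0 < d" by (simp add: eventually_at_right_less)
  ultimately show ?thesis
  proof eventually_elim
    case (elim d)
    show ?case
    proof (intro conjI allI impI)
      fix w z :: 'x assume wz: "norm w \<le> R" "norm z \<le> R" "(norm (w - z))\<^sup>2 \<le> error_bound T d (drift * d)"
      have "norm (w - z) < \<eta>"
        by (rule power2_less_imp_less[OF le_less_trans[OF wz(3) elim(1)] less_imp_le[OF \<eta>(1)]])
      then have "dist (\<sigma> w) (\<sigma> z) < e" using wz by (intro \<eta>(2)) (auto simp: dist_norm)
      then show "\<bar>\<sigma> w - \<sigma> z\<bar> \<le> e" by (simp add: dist_norm)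
    qed (rule elim(2))
  qed
qed

lemma deviation_value:
  assumes "cooperative c coop" "punishing c pun" "U = shift_strategy P f inflate coop pun"
    and "t\<^sub>0 \<in> {0..T}" "reach t\<^sub>0 x\<^sub>0" and \<sigma>: "continuous_on UNIV \<sigma>" "\<And>x. c T x = \<sigma> x"
  shows "Lim (at_right 0) (\<lambda>\<delta>. SUP y\<in>outcomes1 T f g Q U t\<^sub>0 x\<^sub>0 \<delta>. ereal (\<sigma> y)) \<le> ereal (c t\<^sub>0 x\<^sub>0)"
proof (rule Lim_SUP_le)
  show "outcomes1 T f g Q U t\<^sub>0 x\<^sub>0 d \<subseteq> outcomes1 T f g Q U t\<^sub>0 x\<^sub>0 d'" if "d \<le> d'" for d d'
    using that by (fastforce simp: outcomes1_def)
  fix e :: real assume "0 < e"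
  show "\<forall>\<^sub>F d in at_right 0. \<forall>z\<in>outcomes1 T f g Q U t\<^sub>0 x\<^sub>0 d. \<sigma> z \<le> c t\<^sub>0 x\<^sub>0 + e"
    using eventually_payoff_close[OF \<sigma>(1) \<open>0 < e\<close>]
  proof eventually_elim
    case (elim d)
    show ?case
    proof
      fix z assume "z \<in> outcomes1 T f g Q U t\<^sub>0 x\<^sub>0 d"
      from deviation_outcome[OF assms(1-5) less_imp_le[OF conjunct1[OF elim]] this] obtain w
        where w: "c T w \<le> c t\<^sub>0 x\<^sub>0" "norm w \<le> R" "norm z \<le> R" "(norm (w - z))\<^sup>2 \<le> error_bound T d (drift * d)" .
      have "\<bar>\<sigma> w - \<sigma> z\<bar> \<le> e" using conjunct2[OF elim, rule_format, OF w(2-4)] .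
      with w(1) show "\<sigma> z \<le> c t\<^sub>0 x\<^sub>0 + e" using \<sigma>(2)[of w] by linarith
    qed
  qed
qed

lemma cooperation_value:
  assumes "cooperative c coop" "U = shift_strategy P f inflate coop pun\<^sub>1" "V = shift_strategy Q g inflate coop pun\<^sub>2"
    and "t\<^sub>0 \<in> {0..T}" "reach t\<^sub>0 x\<^sub>0" and \<sigma>: "continuous_on UNIV \<sigma>" "\<And>x. c T x = \<sigma> x"
  shows "payoff T f g \<sigma> U V t\<^sub>0 x\<^sub>0 = ereal (c t\<^sub>0 x\<^sub>0)"
  unfolding payoff_def
proof (rule Lim_INF_eq)
  interpret S: game T Q P g f L K by (rule swap)
  show "outcomes_c T f g U V t\<^sub>0 x\<^sub>0 d \<noteq> {}" if "0 < d" for d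
    using is_guide_strategy_shift_strategy S.is_guide_strategy_shift_strategy assms that
    by (intro outcomes_c_nonempty) auto
  fix e :: real assume "0 < e"
  show "\<forall>\<^sub>F d in at_right 0. \<forall>z\<in>outcomes_c T f g U V t\<^sub>0 x\<^sub>0 d. \<bar>\<sigma> z - c t\<^sub>0 x\<^sub>0\<bar> \<le> e"
    using eventually_payoff_close[OF \<sigma>(1) \<open>0 < e\<close>]
  proof eventually_elim
    case (elim d)
    show ?case
    proof
      fix z assume "z \<in> outcomes_c T f g U V t\<^sub>0 x\<^sub>0 d"
      from cooperation_outcome[OF assms(1-5) less_imp_le[OF conjunct1[OF elim]] this] obtain w
        where w: "c T w = c t\<^sub>0 x\<^sub>0" "norm w \<le> R" "norm z \<le> R" "(norm (w - z))\<^sup>2 \<le> error_bound T d (drift * d)" .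
      have "\<bar>\<sigma> w - \<sigma> z\<bar> \<le> e" using conjunct2[OF elim, rule_format, OF w(2-4)] .
      with w(1) show "\<bar>\<sigma> z - c t\<^sub>0 x\<^sub>0\<bar> \<le> e" using \<sigma>(2)[of w] by linarith
    qed
  qed
qed

end

section \<open>Constants for a compact set of initial positions\<close>

lemma game_exists:
  assumes "0 \<le> T" "compact P" "P \<noteq> {}" "compact Q" "Q \<noteq> {}"
    "continuous_on ({0..T} \<times> UNIV \<times> P) (\<lambda>(t, x, u). f t x u)"
    "continuous_on ({0..T} \<times> UNIV \<times> Q) (\<lambda>(t, x, v). g t x v)"
    "lipschitz_in_state T P f" "lipschitz_in_state T Q g"
    "sublinear_growth T P f" "sublinear_growth T Q g"
  obtains L K where "game T P Q f g L K"
proof -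
  obtain L1 L2 where L: "\<forall>t\<in>{0..T}. \<forall>u\<in>P. L1-lipschitz_on UNIV (\<lambda>x. f t x u)"
    "\<forall>t\<in>{0..T}. \<forall>u\<in>Q. L2-lipschitz_on UNIV (\<lambda>x. g t x u)"
    using assms by (auto simp: lipschitz_in_state_def)
  obtain K1 K2 where K: "\<forall>t\<in>{0..T}. \<forall>x. \<forall>u\<in>P. norm (f t x u) \<le> K1 * (1 + norm x)"
    "\<forall>t\<in>{0..T}. \<forall>x. \<forall>u\<in>Q. norm (g t x u) \<le> K2 * (1 + norm x)"
    using assms by (auto simp: sublinear_growth_def)
  have le: "C * d \<le> max 0 (max C D) * d" "D * d \<le> max 0 (max C D) * d" if "0 \<le> d" for C D d :: real
    using that by (auto intro!: mult_right_mono)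
  have lip: "norm (f t x u - f t y u) \<le> L1 * norm (x - y)" "norm (g t x v - g t y v) \<le> L2 * norm (x - y)"
    if "t \<in> {0..T}" "u \<in> P" "v \<in> Q" for t x y u v
    using L that lipschitz_onD[of L1 UNIV "\<lambda>x. f t x u" x y] lipschitz_onD[of L2 UNIV "\<lambda>x. g t x v" x y]
    by (auto simp: dist_norm)
  obtain u\<^sub>0 v\<^sub>0 where ne: "u\<^sub>0 \<in> P" "v\<^sub>0 \<in> Q" using assms by auto
  show thesis
  proof (rule that[of "max 0 (max L1 L2)" "max 0 (max K1 K2)"], unfold_locales)
    fix t x y u assume *: "t \<in> {0..T}" "u \<in> P"
    show "norm (f t x u - f t y u) \<le> max 0 (max L1 L2) * norm (x - y)"
      by (rule order_trans[OF lip(1)[OF * ne(2)] le(1)]) simp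
    show "norm (f t x u) \<le> max 0 (max K1 K2) * (1 + norm x)"
      by (rule order_trans[OF K(1)[rule_format, OF *] le(1)]) (auto intro: add_nonneg_nonneg)
  next
    fix t x y v assume *: "t \<in> {0..T}" "v \<in> Q"
    show "norm (g t x v - g t y v) \<le> max 0 (max L1 L2) * norm (x - y)"
      by (rule order_trans[OF lip(2)[OF *(1) ne(1) *(2)] le(2)]) simp
    show "norm (g t x v) \<le> max 0 (max K1 K2) * (1 + norm x)"
      by (rule order_trans[OF K(2)[rule_format, OF *] le(2)]) (auto intro: add_nonneg_nonneg)
  qed (use assms in auto)
qed

lemma (in game) time_modulus:
  obtains \<omega> where "\<And>h h'. 0 \<le> h \<Longrightarrow> h \<le> h' \<Longrightarrow> \<omega> h \<le> \<omega> h'" "\<And>h. 0 \<le> h \<Longrightarrow> 0 \<le> \<omega> h"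
    "(\<omega> \<longlongrightarrow> 0) (at_right 0)"
    "\<And>s t x u h. s \<in> {0..T} \<Longrightarrow> t \<in> {0..T} \<Longrightarrow> norm x \<le> R \<Longrightarrow> u \<in> P \<Longrightarrow> \<bar>s - t\<bar> \<le> h \<Longrightarrow>
      norm (f s x u - f t x u) \<le> \<omega> h"
proof -
  have "compact ({0..T} \<times> (cball 0 R :: 'x set) \<times> P)"
    by (intro compact_Times) (simp_all add: P)
  moreover have "continuous_on ({0..T} \<times> cball 0 R \<times> P) (\<lambda>(t, x, u). f t x u)"
    by (rule continuous_on_subset[OF cont_f]) auto
  ultimately obtain \<omega> where \<omega>: "\<And>h h'. 0 \<le> h \<Longrightarrow> h \<le> h' \<Longrightarrow> \<omega> h \<le> \<omega> h'" "\<And>h. 0 \<le> h \<Longrightarrow> 0 \<le> \<omega> h"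
    "(\<omega> \<longlongrightarrow> 0) (at_right 0)"
    "\<And>h p q. p \<in> {0..T} \<times> cball 0 R \<times> P \<Longrightarrow> q \<in> {0..T} \<times> cball 0 R \<times> P \<Longrightarrow> dist p q \<le> h \<Longrightarrow>
      dist (case p of (t, x, u) \<Rightarrow> f t x u) (case q of (t, x, u) \<Rightarrow> f t x u) \<le> \<omega> h"
    using modulus_of_continuity by blast
  have "norm (f s x u - f t x u) \<le> \<omega> h"
    if "s \<in> {0..T}" "t \<in> {0..T}" "norm x \<le> R" "u \<in> P" "\<bar>s - t\<bar> \<le> h" for s t x u h
    using \<omega>(4)[of "(s, x, u)" "(t, x, u)" h] that by (simp add: dist_Pair_Pair dist_norm)
  with \<omega>(1-3) show thesis by (rule that)
qed

lemma (in game) bounded_game_exists: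
  assumes "compact (G :: (real \<times> 'x) set)" "G \<subseteq> {0..T} \<times> UNIV"
  obtains R\<^sub>0 R M \<omega> where "bounded_game T P Q f g L K R\<^sub>0 R M \<omega>"
    "\<And>t x. (t, x) \<in> G \<Longrightarrow> norm x \<le> R\<^sub>0"
proof -
  interpret S: game T Q P g f L K by (rule swap)
  have "bounded (snd ` G)"
    using assms by (intro compact_imp_bounded compact_continuous_image continuous_intros)
  then obtain B where B: "0 < B" "\<And>x. x \<in> snd ` G \<Longrightarrow> norm x \<le> B" by (auto simp: bounded_pos)
  define R where "R = (1 + B) * exp (2 * K * T)"
  obtain \<omega> where \<omega>: "\<And>h h'. 0 \<le> h \<Longrightarrow> h \<le> h' \<Longrightarrow> \<omega> h \<le> \<omega> h'" "\<And>h. 0 \<le> h \<Longrightarrow> 0 \<le> \<omega> h"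
    "(\<omega> \<longlongrightarrow> 0) (at_right 0)"
    "\<And>s t x u h. s \<in> {0..T} \<Longrightarrow> t \<in> {0..T} \<Longrightarrow> norm x \<le> R \<Longrightarrow> u \<in> P \<Longrightarrow> \<bar>s - t\<bar> \<le> h \<Longrightarrow>
      norm (f s x u - f t x u) \<le> \<omega> h"
    using time_modulus[of R] by blast
  obtain \<omega>' where \<omega>': "\<And>h h'. 0 \<le> h \<Longrightarrow> h \<le> h' \<Longrightarrow> \<omega>' h \<le> \<omega>' h'" "\<And>h. 0 \<le> h \<Longrightarrow> 0 \<le> \<omega>' h"
    "(\<omega>' \<longlongrightarrow> 0) (at_right 0)"
    "\<And>s t x v h. s \<in> {0..T} \<Longrightarrow> t \<in> {0..T} \<Longrightarrow> norm x \<le> R \<Longrightarrow> v \<in> Q \<Longrightarrow> \<bar>s - t\<bar> \<le> h \<Longrightarrow>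
      norm (g s x v - g t x v) \<le> \<omega>' h"
    using S.time_modulus[of R] by blast
  have "bounded_game T P Q f g L K B R (2 * K * R) (\<lambda>h. \<omega> h + \<omega>' h)"
  proof unfold_locales
    show "((\<lambda>h. \<omega> h + \<omega>' h) \<longlongrightarrow> 0) (at_right 0)" using tendsto_add[OF \<omega>(3) \<omega>'(3)] by simp
    show "\<omega> h + \<omega>' h \<le> \<omega> h' + \<omega>' h'" if "0 \<le> h" "h \<le> h'" for h h'
      using \<omega>(1)[OF that] \<omega>'(1)[OF that] by simp
    show "norm (f s x u - f t x u) \<le> \<omega> h + \<omega>' h"
      if "s \<in> {0..T}" "t \<in> {0..T}" "norm x \<le> R" "u \<in> P" "\<bar>s - t\<bar> \<le> h" for s t x u h
      using \<omega>(4)[OF that] \<omega>'(2)[of h] abs_ge_zero[of "s - t"] that(5) by linarith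
    show "norm (g s x v - g t x v) \<le> \<omega> h + \<omega>' h"
      if "s \<in> {0..T}" "t \<in> {0..T}" "norm x \<le> R" "v \<in> Q" "\<bar>s - t\<bar> \<le> h" for s t x v h
      using \<omega>'(4)[OF that] \<omega>(2)[of h] abs_ge_zero[of "s - t"] that(5) by linarith
  qed (use B R_def \<omega>(2) \<omega>'(2) in auto)
  with B(2) show thesis by (intro that) force+
qed

section \<open>The equilibrium\<close>

theorem theorem3p1:
  fixes T :: real
    and P :: "'p::metric_space set" and Q :: "'q::metric_space set"
    and f :: "real \<Rightarrow> real ^ 'n \<Rightarrow> 'p \<Rightarrow> real ^ 'n"
    and g :: "real \<Rightarrow> real ^ 'n \<Rightarrow> 'q \<Rightarrow> real ^ 'n"
    and \<sigma>1 \<sigma>2 :: "real ^ 'n \<Rightarrow> real"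
    and c1 c2 :: "real \<Rightarrow> real ^ 'n \<Rightarrow> real"
    and G :: "(real \<times> (real ^ 'n)) set"
  assumes "0 \<le> T"
    and "compact P" and "P \<noteq> {}" and "compact Q" and "Q \<noteq> {}"
    and "continuous_on ({0..T} \<times> UNIV \<times> P) (\<lambda>(t, x, u). f t x u)"
    and "continuous_on ({0..T} \<times> UNIV \<times> Q) (\<lambda>(t, x, v). g t x v)"
    and "lipschitz_in_state T P f" and "lipschitz_in_state T Q g"
    and "sublinear_growth T P f" and "sublinear_growth T Q g"
    and "continuous_on UNIV \<sigma>1" and "continuous_on UNIV \<sigma>2"
    and "continuous_on ({0..T} \<times> UNIV) (\<lambda>(t, x). (c1 t x, c2 t x))"
    and F1: "\<And>x. c1 T x = \<sigma>1 x \<and> c2 T x = \<sigma>2 x"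
    and F2: "\<And>s z u. s \<in> {0..T} \<Longrightarrow> u \<in> P \<Longrightarrow>
               \<exists>y\<in>Sol2 T f g Q s z u. \<forall>t\<in>{s..T}. c1 t (y t) \<le> c1 s z"
    and F3: "\<And>s z v. s \<in> {0..T} \<Longrightarrow> v \<in> Q \<Longrightarrow>
               \<exists>y\<in>Sol1 T f g P s z v. \<forall>t\<in>{s..T}. c2 t (y t) \<le> c2 s z"
    and F4: "\<And>s z. s \<in> {0..T} \<Longrightarrow>
               \<exists>y\<in>Sol T f g P Q s z. \<forall>t\<in>{s..T}. c1 t (y t) = c1 s z \<and> c2 t (y t) = c2 s z"
    and "compact G" and "G \<subseteq> {0..T} \<times> UNIV"
  shows "\<exists>U V. nash_equilibrium_on T f g P Q \<sigma>1 \<sigma>2 G U V \<and>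
           (\<forall>(t\<^sub>0, x\<^sub>0)\<in>G. payoff T f g \<sigma>1 U V t\<^sub>0 x\<^sub>0 = ereal (c1 t\<^sub>0 x\<^sub>0) \<and>
                          payoff T f g \<sigma>2 U V t\<^sub>0 x\<^sub>0 = ereal (c2 t\<^sub>0 x\<^sub>0))"
proof -
  obtain L K where "game T P Q f g L K"
    using assms(1-11) by (rule game_exists)
  then interpret game T P Q f g L K .
  obtain R\<^sub>0 R M \<omega> where "bounded_game T P Q f g L K R\<^sub>0 R M \<omega>"
    and G: "\<And>t x. (t, x) \<in> G \<Longrightarrow> norm x \<le> R\<^sub>0"
    using bounded_game_exists[OF \<open>compact G\<close> \<open>G \<subseteq> _\<close>] by blast
  then interpret bounded_game T P Q f g L K R\<^sub>0 R M \<omega> by simp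
  interpret S: bounded_game T Q P g f L K R\<^sub>0 R M \<omega> by (rule swap_bounded)
  obtain coop where coop: "cooperative c1 coop" "cooperative c2 coop"
    using cooperative_exists[of c1 c2, OF F4] .
  obtain pun\<^sub>1 where pun\<^sub>1: "punishing c2 pun\<^sub>1"
    using punishing_exists[of c2, OF F3] .
  obtain pun\<^sub>2 where pun\<^sub>2: "S.punishing c1 pun\<^sub>2"
    using S.punishing_exists[of c1, unfolded Sol1_swap, OF F2] .
  define U where "U = shift_strategy P f inflate coop pun\<^sub>1"
  define V where "V = shift_strategy Q g inflate coop pun\<^sub>2"
  have coop': "S.cooperative c1 coop"
    using coop(1) by (simp only: S.cooperative_def cooperative_def Sol_swap[of T g f Q P])
  have start: "t\<^sub>0 \<in> {0..T}" "reach t\<^sub>0 x\<^sub>0" if "(t\<^sub>0, x\<^sub>0) \<in> G" for t\<^sub>0 x\<^sub>0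
  proof -
    show "t\<^sub>0 \<in> {0..T}" using that \<open>G \<subseteq> _\<close> by auto
    then have "(1 + R\<^sub>0) * 1 \<le> (1 + R\<^sub>0) * exp (2 * K * t\<^sub>0)"
      using R\<^sub>0 K by (intro mult_left_mono) auto
    then show "reach t\<^sub>0 x\<^sub>0" using G[OF that] by (simp add: reach_def)
  qed
  have payoff: "payoff T f g \<sigma>1 U V t\<^sub>0 x\<^sub>0 = ereal (c1 t\<^sub>0 x\<^sub>0)" "payoff T f g \<sigma>2 U V t\<^sub>0 x\<^sub>0 = ereal (c2 t\<^sub>0 x\<^sub>0)"
    if "(t\<^sub>0, x\<^sub>0) \<in> G" for t\<^sub>0 x\<^sub>0
    by (rule cooperation_value[OF coop(1) U_def V_def start[OF that] assms(12)], simp add: F1)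
       (rule cooperation_value[OF coop(2) U_def V_def start[OF that] assms(13)], simp add: F1)
  have deviation1: "Lim (at_right 0) (\<lambda>\<delta>. SUP y\<in>outcomes1 T f g Q U t\<^sub>0 x\<^sub>0 \<delta>. ereal (\<sigma>2 y)) \<le> ereal (c2 t\<^sub>0 x\<^sub>0)"
    if "(t\<^sub>0, x\<^sub>0) \<in> G" for t\<^sub>0 x\<^sub>0
    by (rule deviation_value[OF coop(2) pun\<^sub>1 U_def start[OF that] assms(13)]) (simp add: F1)
  have deviation2: "Lim (at_right 0) (\<lambda>\<delta>. SUP y\<in>outcomes2 T f g P V t\<^sub>0 x\<^sub>0 \<delta>. ereal (\<sigma>1 y)) \<le> ereal (c1 t\<^sub>0 x\<^sub>0)"
    if "(t\<^sub>0, x\<^sub>0) \<in> G" for t\<^sub>0 x\<^sub>0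
    unfolding outcomes1_swap[symmetric]
    by (rule S.deviation_value[OF coop' pun\<^sub>2 V_def start[OF that] assms(12)]) (simp add: F1)
  have "nash_equilibrium_on T f g P Q \<sigma>1 \<sigma>2 G U V"
    unfolding nash_equilibrium_on_def
  proof (intro conjI)
    show "is_guide_strategy T P U" unfolding U_def by (rule is_guide_strategy_shift_strategy)
    show "is_guide_strategy T Q V" unfolding V_def by (rule S.is_guide_strategy_shift_strategy)
  qed (use payoff deviation1 deviation2 in \<open>simp add: split_beta\<close>)
  moreover have "\<forall>(t\<^sub>0, x\<^sub>0)\<in>G. payoff T f g \<sigma>1 U V t\<^sub>0 x\<^sub>0 = ereal (c1 t\<^sub>0 x\<^sub>0) \<and>
      payoff T f g \<sigma>2 U V t\<^sub>0 x\<^sub>0 = ereal (c2 t\<^sub>0 x\<^sub>0)"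
    using payoff by (simp add: split_beta)
  ultimately show ?thesis by blast
qed

end
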